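(* Let $P,Q$ be parameters, $1\le a\le q\le P$ integers with $(a,q)=1$, and let $\alpha\in[\frac aq-\frac1Q,\frac aq+\frac1Q]$, written $\alpha=\frac aq+\lambda$. Assume $\mathcal A$ satisfies Condition D with $Q_D\ge q$, that $A(X)$ is smoothly approximable, and let $m>0$ be arbitrary. Let $\Psi$ be a smooth approximation of $A$ corresponding to this $m$ and $\psi=\Psi'$. Then $$S(\alpha)=S(q,a)I(\lambda,X)+O\big(q^s\lambda X^2A(X)^sL^{-m}\big),$$ where the implied constant may depend on $m$.
   Context: $f\in\mathbb{Z}[x_1,\dots,x_s]$ is a quadratic form; $\mathcal A=(a_x)$ non-negative reals, $A(X)=\sum_{1\le x\le X}a_x$, $A(q,h;X)=\sum_{1\le x\le X,x\equiv h(q)}a_x$, $L=\log X$, $e(z)=e^{2\pi iz}$, $a_{\bm x}=\prod a_{x_i}$, $\kappa(q,\bm h)=\prod\kappa(q,h_i)$. Condition D: for an increasing function $Q_D(X)$, for all $X>1$, $q\le Q_D$ and $h$ mod $q$ there is $\kappa(q,h)\ge0$ with $A(q,h;X)=\kappa(q,h)A(X)+O_m(A(X)L^{-m})$ for every $m\in\mathbb N$. Smoothly approximable: for every $m\in\mathbb N$ there is smooth $\Psi$, $\psi=\Psi'$, with $\Psi(X)=A(X)+O(A(X)L^{-m})$, $\psi(X)\asymp A(X)/X$, and $\int_{yX}^{zX}|\psi'(u)|du\ll_{y,z}A(X)/X$ for all $y,z>0$. Definitions: $S(\alpha)=\sum_{\bm x\in\mathbb{Z}^s,0\le x_i\le X}a_{\bm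 x}e(\alpha f(\bm x))$, $S(q,a)=\sum_{\bm h\bmod q}\kappa(q,\bm h)e(\frac aqf(\bm h))$, $I(\lambda,X)=\int_{[0,X]^s}\psi(\bm u)e(\lambda f(\bm u))\,d\bm u$ with $\psi(\bm u)=\prod\psi(u_i)$.
   Formalization: The error term has max(1,|λ|X²) in place of λX² (false as λ→0); "Q_D ≥ q" is read as q ≤ Q_D(X/L^B) for some B depending on the fixed data (q ≤ Q_D(X) fails); a_x is assumed not identically zero for x ≥ 1; the estimate is for all large X. *)

theory Defs
  imports "HOL-Analysis.Analysis" "HOL-Library.Landau_Symbols" "HOL-Number_Theory.Cong"
begin

definition e :: "real \<Rightarrow> complex" where
  "e z = exp (2 * of_real pi * \<i> * of_real z)"

text \<open>A quadratic form in \<open>\<int>[x\<^sub>0, \<dots>, x\<^bsub>s-1\<^esub>]\<close> is given by one integer coefficient \<open>c i j\<close> for each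
  monomial \<open>x\<^sub>i x\<^sub>j\<close> with \<open>j \<le> i\<close>; in particular, cross terms may have odd coefficients.\<close>

definition qform :: "nat \<Rightarrow> (nat \<Rightarrow> nat \<Rightarrow> int) \<Rightarrow> (nat \<Rightarrow> real) \<Rightarrow> real" where
  "qform s c u = (\<Sum>i<s. \<Sum>j\<le>i. of_int (c i j) * u i * u j)"

definition A :: "(nat \<Rightarrow> real) \<Rightarrow> real \<Rightarrow> real" where
  "A a X = (\<Sum>x\<in>{x. 1 \<le> x \<and> real x \<le> X}. a x)"

definition A_res :: "(nat \<Rightarrow> real) \<Rightarrow> nat \<Rightarrow> nat \<Rightarrow> real \<Rightarrow> real" where
  "A_res a q h X = (\<Sum>x\<in>{x. 1 \<le> x \<and> real x \<le> X \<and> [x = h] (mod q)}. a x)"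

text \<open>Residues \<open>h\<close> modulo \<open>q\<close> are represented by \<open>0 \<le> h < q\<close>. The density \<open>\<kappa> q h\<close> does not depend
  on \<open>X\<close>, and the implied constant depends on \<open>m\<close> only, being uniform in \<open>X\<close>, \<open>q\<close> and \<open>h\<close>.\<close>

definition condition_D :: "(nat \<Rightarrow> real) \<Rightarrow> (real \<Rightarrow> real) \<Rightarrow> (nat \<Rightarrow> nat \<Rightarrow> real) \<Rightarrow> bool" where
  "condition_D a Q\<^sub>D \<kappa> \<longleftrightarrow>
     mono_on {1<..} Q\<^sub>D \<and>
     (\<forall>X>1. \<forall>q\<ge>1. real q \<le> Q\<^sub>D X \<longrightarrow> (\<forall>h<q. \<kappa> q h \<ge> 0)) \<and>
     (\<forall>m::nat. \<exists>C. \<forall>X>1. \<forall>q\<ge>1. real q \<le> Q\<^sub>D X \<longrightarrow>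
        (\<forall>h<q. \<bar>A_res a q h X - \<kappa> q h * A a X\<bar> \<le> C * (A a X / ln X ^ m)))"

definition smooth_on_pos :: "(real \<Rightarrow> real) \<Rightarrow> bool" where
  "smooth_on_pos g \<longleftrightarrow> (\<forall>k. \<forall>x>0. (deriv ^^ k) g field_differentiable (at x))"

text \<open>The estimates are for \<open>X\<close> tending to infinity: the relation \<open>\<psi>(X) \<asymp> A(X)/X\<close> cannot hold with
  continuous \<open>\<psi>\<close> across a point where \<open>A\<close> first becomes positive. Smoothness is required on
  \<open>(0,\<infinity>)\<close> only, which allows \<open>\<Psi>(X) = X powr \<theta>\<close> with \<open>0 < \<theta> < 1\<close>. Integrability of \<open>\<psi>\<close> near \<open>0\<close>
  is what makes the integrals of \<open>\<psi>\<close> over \<open>[0,X]\<close> meaningful.\<close>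

definition smooth_approx :: "(nat \<Rightarrow> real) \<Rightarrow> nat \<Rightarrow> (real \<Rightarrow> real) \<Rightarrow> bool" where
  "smooth_approx a m \<Psi> \<longleftrightarrow>
     smooth_on_pos \<Psi> \<and>
     (\<forall>X>0. set_integrable lborel {0..X} (deriv \<Psi>)) \<and>
     (\<lambda>X. \<Psi> X - A a X) \<in> O[at_top](\<lambda>X. A a X / ln X ^ m) \<and>
     (\<exists>c\<^sub>1>0. \<exists>c\<^sub>2. \<forall>\<^sub>F X in at_top.
        c\<^sub>1 * (A a X / X) \<le> deriv \<Psi> X \<and> deriv \<Psi> X \<le> c\<^sub>2 * (A a X / X)) \<and>
     (\<forall>y>0. \<forall>z>0. (\<lambda>X. integral {y * X..z * X} (\<lambda>u. \<bar>deriv (deriv \<Psi>) u\<bar>))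
        \<in> O[at_top](\<lambda>X. A a X / X))"

definition smoothly_approximable :: "(nat \<Rightarrow> real) \<Rightarrow> bool" where
  "smoothly_approximable a \<longleftrightarrow> (\<forall>m. \<exists>\<Psi>. smooth_approx a m \<Psi>)"

definition exp_sum :: "nat \<Rightarrow> (nat \<Rightarrow> nat \<Rightarrow> int) \<Rightarrow> (nat \<Rightarrow> real) \<Rightarrow> real \<Rightarrow> real \<Rightarrow> complex" where
  "exp_sum s c a X \<alpha> =
     (\<Sum>x \<in> {..<s} \<rightarrow>\<^sub>E {n::nat. real n \<le> X}.
        of_real (\<Prod>i<s. a (x i)) * e (\<alpha> * qform s c (\<lambda>i. real (x i))))"

definition gauss_sum :: "nat \<Rightarrow> (nat \<Rightarrow> nat \<Rightarrow> int) \<Rightarrow> (nat \<Rightarrow> nat \<Rightarrow> real) \<Rightarrow> nat \<Rightarrow> nat \<Rightarrow> complex" where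
  "gauss_sum s c \<kappa> q b =
     (\<Sum>h \<in> {..<s} \<rightarrow>\<^sub>E {..<q}.
        of_real (\<Prod>i<s. \<kappa> q (h i)) * e (real b / real q * qform s c (\<lambda>i. real (h i))))"

definition sing_int ::
  "nat \<Rightarrow> (nat \<Rightarrow> nat \<Rightarrow> int) \<Rightarrow> (real \<Rightarrow> real) \<Rightarrow> real \<Rightarrow> real \<Rightarrow> complex" where
  "sing_int s c \<psi> lam X =
     (LINT u : ({..<s} \<rightarrow>\<^sub>E {0..X}) | (\<Pi>\<^sub>M i\<in>{..<s}. lborel).
        of_real (\<Prod>i<s. \<psi> (u i)) * e (lam * qform s c u))"

text \<open>In the theorem, the error term carries \<open>max 1 (\<bar>lam\<bar> X\<^sup>2)\<close> because the boundary terms of partial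
  summation do not vanish as \<open>lam \<rightarrow> 0\<close>; for \<open>\<bar>lam\<bar> X\<^sup>2 \<ge> 1\<close> it is \<open>\<bar>lam\<bar> X\<^sup>2\<close>. The bound on \<open>q\<close> in terms
  of \<open>Q\<^sub>D\<close> is imposed at \<open>X / (log X)\<^sup>B\<close>, since equidistribution modulo \<open>q\<close> is used at all
  points \<open>t\<close> with \<open>X / (log X)\<^sup>B \<le> t \<le> X\<close> and not only at \<open>t = X\<close>.\<close>

end

theory Submission
  imports Defs "HOL-Real_Asymp.Real_Asymp"
begin

text \<open>Splitting the variables into residue classes \<open>h\<close> modulo \<open>q\<close> turns \<open>S(\<alpha>)\<close> into a sum over \<open>h\<close> of
  \<open>e(b f(h)/q)\<close> times a sum over \<open>x \<equiv> h\<close> of \<open>a\<^sub>x e(\<lambda> f(x))\<close>. In each coordinate, the counting function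
  of \<open>a\<close> in the class differs from \<open>\<kappa>(q,h)\<close> times the primitive of \<open>\<psi>\<close> by \<open>O(A(X) L\<^sup>-\<^sup>m)\<close>, uniformly on
  \<open>[0,X]\<close>: near \<open>X\<close> by Condition D, and below \<open>X/L\<^sup>B\<close> because \<open>A\<close> grows at least like a power of \<open>X\<close>.
  Each coordinate derivative of \<open>e(\<lambda> f(u))\<close> is \<open>O(\<bar>\<lambda>\<bar> X)\<close> on the box, so exchanging a sum for an
  integral in one coordinate costs \<open>O((1 + \<bar>\<lambda>\<bar> X\<^sup>2) A(X)\<^sup>s L\<^sup>-\<^sup>m)\<close>, and there are \<open>q\<^sup>s\<close> classes.\<close>

section \<open>Partial summation\<close>

lemma finite_nat_le_real [simp]: "finite {n::nat. real n \<le> t}"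
proof (rule finite_subset)
  show "{n::nat. real n \<le> t} \<subseteq> {..nat \<lceil>t\<rceil>}" by (auto, linarith)
qed simp

text \<open>Provides the dominating function that justifies Fubini over the triangle
  \<open>u \<le> t\<close> in the partial summation.\<close>

lemma integrable_lborel_product:
  fixes f :: "real \<Rightarrow> real" and g :: "real \<Rightarrow> complex"
  assumes [measurable]: "integrable lborel f" "integrable lborel g"
  shows "integrable (lborel \<Otimes>\<^sub>M lborel) (\<lambda>(u, t). of_real (f u) * g t)"
proof (rule lborel_pair.Fubini_integrable)
  show "integrable lborel (\<lambda>u. \<integral> t. norm (case (u, t) of (u, t) \<Rightarrow> of_real (f u) * g t) \<partial>lborel)"
    using assms by (simp add: norm_mult)
  show "AE u in lborel. integrable lborel (\<lambda>t. case (u, t) of (u, t) \<Rightarrow> of_real (f u) * g t)"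
    using assms by simp
qed measurable

text \<open>Writing \<open>g(u) = g(X) - \<integral>\<^bsub>u\<^esub>\<^bsup>X\<^esup> g'\<close> for both the sum and the integral and exchanging the order
  of integration leaves only the discrepancy of the two distribution functions.\<close>

lemma partial_summation_discrepancy:
  fixes w :: "nat \<Rightarrow> real" and \<phi> :: "real \<Rightarrow> real" and g g' :: "real \<Rightarrow> complex"
  assumes X: "0 \<le> X"
    and \<phi>: "integrable lborel \<phi>"
    and supp: "\<And>t. t \<notin> {0..X} \<Longrightarrow> \<phi> t = 0"
    and g: "\<And>t. (g has_vector_derivative g' t) (at t)"
    and cont: "continuous_on UNIV g'"
    and K: "\<And>t. t \<in> {0..X} \<Longrightarrow> norm (g' t) \<le> K"
    and gX: "norm (g X) \<le> 1"
    and D: "\<And>t. t \<in> {0..X} \<Longrightarrow> \<bar>(\<Sum>n | real n \<le> t. w n) - (LINT u:{0..t}|lborel. \<phi> u)\<bar> \<le> D"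
  shows "norm ((\<Sum>n | real n \<le> X. of_real (w n) * g (real n)) - (LINT u|lborel. of_real (\<phi> u) * g u))
    \<le> D * (1 + K * X)"
proof -
  let ?N = "{n::nat. real n \<le> X}"
  \<comment> \<open>Cutting the derivative off at the ends of [0,X] turns every integral from
    \<open>u\<close> to \<open>X\<close> into one over the whole line, with \<open>u\<close>
    entering only through an indicator.\<close>
  define k where "k t = indicator {0..X} t *\<^sub>R g' t" for t
  have k: "integrable lborel k"
    using borel_integrable_atLeastAtMost'[of 0 X g'] continuous_on_subset[OF cont]
    unfolding set_integrable_def k_def by auto
  note [measurable] = borel_measurable_integrable[OF \<phi>] borel_measurable_integrable[OF k]
  have ind_k: "integrable lborel (\<lambda>t. indicator {u..} t *\<^sub>R k t)" for u
    by (rule Bochner_Integration.integrable_bound[OF k]) (auto split: split_indicator)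
  have ftc: "g u = g X - (LINT t|lborel. indicator {u..} t *\<^sub>R k t)" if "u \<in> {0..X}" for u
  proof -
    have "(LINT t|lborel. indicator {u..} t *\<^sub>R k t) = (LINT t|lborel. indicator {u..X} t *\<^sub>R g' t)"
      using that by (intro Bochner_Integration.integral_cong) (auto simp: k_def split: split_indicator)
    also have "\<dots> = g X - g u"
      using that continuous_on_subset[OF cont]
      by (intro integral_FTC_Icc) (auto intro: has_vector_derivative_at_within g)
    finally show ?thesis by simp
  qed
  \<comment> \<open>The two distribution functions, with the condition \<open>u \<le> t\<close>
    written as an indicator so that sums and integrals over \<open>u\<close> and over
    \<open>t\<close> can be exchanged. As only \<open>n\<close> up to \<open>X\<close> enter,
    \<open>W\<close> counts correctly just for \<open>t\<close> in [0,X], which is where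
    \<open>k\<close> lives.\<close>
  define W where "W t = (\<Sum>n\<in>?N. w n * indicator {real n..} t)" for t
  define F where "F t = (LINT u|lborel. \<phi> u * indicator {u..} t)" for t
  have W_eq: "W t = (\<Sum>n | real n \<le> t. w n)" if "t \<in> {0..X}" for t
  proof -
    have "W t = (\<Sum>n\<in>?N. if real n \<le> t then w n else 0)"
      unfolding W_def by (intro sum.cong) (auto split: split_indicator)
    also have "\<dots> = (\<Sum>n\<in>?N \<inter> {n. real n \<le> t}. w n)"
      by (simp add: sum.inter_restrict)
    also have "?N \<inter> {n. real n \<le> t} = {n. real n \<le> t}" using that by auto
    finally show ?thesis .
  qed
  have F_eq: "F t = (LINT u:{0..t}|lborel. \<phi> u)" for t
    unfolding F_def set_lebesgue_integral_def
    by (intro Bochner_Integration.integral_cong) (use supp in \<open>auto split: split_indicator\<close>)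
  have sum_eq: "(\<Sum>n\<in>?N. of_real (w n) * g (real n))
      = of_real (W X) * g X - (LINT t|lborel. W t *\<^sub>R k t)"
  proof -
    have "(\<Sum>n\<in>?N. of_real (w n) * g (real n))
        = (\<Sum>n\<in>?N. of_real (w n) * g X - (LINT t|lborel. w n *\<^sub>R (indicator {real n..} t *\<^sub>R k t)))"
    proof (rule sum.cong[OF refl])
      fix n assume "n \<in> ?N"
      then have gn: "g (real n) = g X - (LINT t|lborel. indicator {real n..} t *\<^sub>R k t)"
        by (intro ftc) auto
      show "of_real (w n) * g (real n)
          = of_real (w n) * g X - (LINT t|lborel. w n *\<^sub>R (indicator {real n..} t *\<^sub>R k t))"
        unfolding gn integral_scaleR_right by (simp add: algebra_simps scaleR_conv_of_real)
    qed
    also have "\<dots> = of_real (\<Sum>n\<in>?N. w n) * g X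
        - (LINT t|lborel. (\<Sum>n\<in>?N. w n *\<^sub>R (indicator {real n..} t *\<^sub>R k t)))"
      using ind_k by (simp add: sum_subtractf sum_distrib_right del: scaleR_scaleR)
    also have "(\<lambda>t. \<Sum>n\<in>?N. w n *\<^sub>R (indicator {real n..} t *\<^sub>R k t)) = (\<lambda>t. W t *\<^sub>R k t)"
      by (simp only: W_def scaleR_sum_left scaleR_scaleR)
    finally show ?thesis using W_eq[of X] X by simp
  qed
  let ?h = "\<lambda>u t. of_real (\<phi> u) * (indicator {u..} t *\<^sub>R k t)"
  have int: "integrable (lborel \<Otimes>\<^sub>M lborel) (\<lambda>(u, t). ?h u t)"
  proof (rule Bochner_Integration.integrable_bound[OF integrable_lborel_product[OF \<phi> k]])
    \<comment> \<open>Joint measurability becomes visible once the indicator is that of the closed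
      half plane \<open>fst p \<le> snd p\<close>.\<close>
    have "(\<lambda>(u, t). of_real (\<phi> u) * (indicator {p. fst p \<le> snd p} (u, t) *\<^sub>R k t))
        \<in> borel_measurable (lborel \<Otimes>\<^sub>M lborel)"
      by measurable
    also have "(\<lambda>(u, t). of_real (\<phi> u) * (indicator {p. fst p \<le> snd p} (u, t) *\<^sub>R k t)) = (\<lambda>(u, t). ?h u t)"
      by (auto split: split_indicator)
    finally show "(\<lambda>(u, t). ?h u t) \<in> borel_measurable (lborel \<Otimes>\<^sub>M lborel)" .
  qed (auto split: split_indicator simp: norm_mult)
  have inner: "(LINT u|lborel. ?h u t) = F t *\<^sub>R k t" for t
  proof -
    have "(\<lambda>u. ?h u t) = (\<lambda>u. of_real (\<phi> u * indicator {u..} t) * k t)"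
      by (auto split: split_indicator)
    then show ?thesis
      by (simp only: integral_mult_left_zero integral_complex_of_real F_def scaleR_conv_of_real)
  qed
  have int_eq: "(LINT u|lborel. of_real (\<phi> u) * g u)
      = of_real (F X) * g X - (LINT t|lborel. F t *\<^sub>R k t)"
  proof -
    have "(LINT u|lborel. of_real (\<phi> u) * g u)
        = (LINT u|lborel. of_real (\<phi> u) * g X - (LINT t|lborel. ?h u t))"
    proof (rule Bochner_Integration.integral_cong[OF refl])
      fix u
      show "of_real (\<phi> u) * g u = of_real (\<phi> u) * g X - (LINT t|lborel. ?h u t)"
      proof (cases "u \<in> {0..X}")
        case True
        then show ?thesis
          by (simp only: ftc[OF True] integral_mult_right_zero right_diff_distrib)
      next
        case False
        then show ?thesis by (simp add: supp)
      qed
    qed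
    also have "\<dots> = (LINT u|lborel. of_real (\<phi> u) * g X) - (LINT u|lborel. LINT t|lborel. ?h u t)"
      using lborel_pair.integrable_fst[OF int] \<phi> by (intro Bochner_Integration.integral_diff) auto
    also have "(LINT u|lborel. LINT t|lborel. ?h u t) = (LINT t|lborel. LINT u|lborel. ?h u t)"
      by (rule lborel_pair.Fubini_integral[symmetric, OF int])
    also have "(LINT t|lborel. LINT u|lborel. ?h u t) = (LINT t|lborel. F t *\<^sub>R k t)"
      by (simp only: inner)
    also have "(LINT u|lborel. of_real (\<phi> u) * g X) = of_real (LINT u|lborel. \<phi> u) * g X"
      by (simp only: integral_mult_left_zero integral_complex_of_real)
    also have "(LINT u|lborel. \<phi> u) = F X"
      unfolding F_def by (intro Bochner_Integration.integral_cong) (use supp in \<open>auto split: split_indicator\<close>)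
    finally show ?thesis .
  qed
  have D0: "0 \<le> D" using D[of X] X by (auto intro: order_trans[OF abs_ge_zero])
  have Wk: "integrable lborel (\<lambda>t. W t *\<^sub>R k t)"
    unfolding W_def scaleR_sum_left scaleR_scaleR[symmetric]
    by (intro Bochner_Integration.integrable_sum integrable_scaleR_right ind_k)
  have Fk: "integrable lborel (\<lambda>t. F t *\<^sub>R k t)"
    using lborel_pair.integrable_snd[OF int] by (simp only: inner)
  \<comment> \<open>After the exchange the sum and the integral differ by the boundary term at
    \<open>X\<close> and by this integral, whose integrand is at most \<open>D * K\<close> on [0,X]
    and zero elsewhere.\<close>
  have "norm (LINT t|lborel. (W t - F t) *\<^sub>R k t) \<le> (LINT t|lborel. indicator {0..X} t *\<^sub>R (D * K))"
  proof (rule Bochner_Integration.integral_norm_bound_integral)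
    show "integrable lborel (\<lambda>t. (W t - F t) *\<^sub>R k t)"
      using Wk Fk by (simp add: scaleR_diff_left)
    show "integrable lborel (\<lambda>t. indicator {0..X} t *\<^sub>R (D * K))"
      using borel_integrable_atLeastAtMost'[of 0 X "\<lambda>_. D * K"] by (simp add: set_integrable_def)
    show "norm ((W t - F t) *\<^sub>R k t) \<le> indicator {0..X} t *\<^sub>R (D * K)" for t
      using D[of t] K[of t] W_eq[of t] F_eq[of t] D0
      by (auto simp: k_def split: split_indicator intro!: mult_mono)
  qed
  also have "\<dots> = D * K * X" using X by simp
  finally have 1: "norm (LINT t|lborel. (W t - F t) *\<^sub>R k t) \<le> D * K * X" .
  have "\<bar>W X - F X\<bar> * norm (g X) \<le> D * 1"
    using D[of X] W_eq[of X] F_eq[of X] D0 X gX by (intro mult_mono) auto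
  then have 2: "norm (of_real (W X - F X) * g X) \<le> D" 
    by (simp add: norm_mult del: of_real_diff)
  have "(\<Sum>n\<in>?N. of_real (w n) * g (real n)) - (LINT u|lborel. of_real (\<phi> u) * g u)
      = of_real (W X - F X) * g X - (LINT t|lborel. (W t - F t) *\<^sub>R k t)"
    unfolding sum_eq int_eq scaleR_diff_left Bochner_Integration.integral_diff[OF Wk Fk]
      of_real_diff left_diff_distrib by simp
  also have "norm \<dots> \<le> D + D * K * X"
    using 1 2 by (intro order_trans[OF norm_triangle_ineq4]) linarith
  finally show ?thesis by (simp add: algebra_simps)
qed

text \<open>The sums are replaced by integrals one coordinate at a time: the induction hypothesis treats the
  first \<open>n\<close> coordinates with the last one frozen at an integer, and one-dimensional partial summation
  treats the last one under the integral over the others.\<close>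

lemma product_discrepancy:
  fixes n :: nat and w :: "nat \<Rightarrow> nat \<Rightarrow> real" and \<phi> :: "nat \<Rightarrow> real \<Rightarrow> real"
    and G :: "(nat \<Rightarrow> real) \<Rightarrow> complex" and H :: "nat \<Rightarrow> (nat \<Rightarrow> real) \<Rightarrow> complex"
  assumes nonneg: "0 \<le> X" "0 \<le> M" "0 \<le> D" "0 \<le> K"
    and w: "\<And>i. i < n \<Longrightarrow> (\<Sum>k | real k \<le> X. \<bar>w i k\<bar>) \<le> M"
    and \<phi>: "\<And>i. i < n \<Longrightarrow> integrable lborel (\<phi> i)"
    and supp: "\<And>i t. i < n \<Longrightarrow> t \<notin> {0..X} \<Longrightarrow> \<phi> i t = 0"
    and \<phi>_le: "\<And>i. i < n \<Longrightarrow> (LINT t|lborel. \<bar>\<phi> i t\<bar>) \<le> M"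
    and D: "\<And>i t. i < n \<Longrightarrow> t \<in> {0..X} \<Longrightarrow>
      \<bar>(\<Sum>k | real k \<le> t. w i k) - (LINT u:{0..t}|lborel. \<phi> i u)\<bar> \<le> D"
    and G: "G \<in> borel_measurable (\<Pi>\<^sub>M i\<in>{..<n}. lborel)"
    and G_cong: "\<And>u v. (\<And>i. i < n \<Longrightarrow> u i = v i) \<Longrightarrow> G u = G v"
    and G_le: "\<And>u. norm (G u) \<le> 1"
    and deriv: "\<And>i u t. i < n \<Longrightarrow> ((\<lambda>t. G (u(i := t))) has_vector_derivative H i (u(i := t))) (at t)"
    and cont: "\<And>i u. i < n \<Longrightarrow> continuous_on UNIV (\<lambda>t. H i (u(i := t)))"
    and K: "\<And>i u. i < n \<Longrightarrow> (\<And>j. j < n \<Longrightarrow> u j \<in> {0..X}) \<Longrightarrow> norm (H i u) \<le> K"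
  shows "norm ((\<Sum>x\<in>{..<n} \<rightarrow>\<^sub>E {k. real k \<le> X}. of_real (\<Prod>i<n. w i (x i)) * G (\<lambda>i. real (x i)))
      - (LINT u|(\<Pi>\<^sub>M i\<in>{..<n}. lborel). of_real (\<Prod>i<n. \<phi> i (u i)) * G u))
    \<le> real n * M ^ (n - 1) * (D * (1 + K * X))"
  using w \<phi> supp \<phi>_le D G G_cong G_le deriv cont K
proof (induction n arbitrary: G H)
  case 0
  \<comment> \<open>With no coordinates, the sum and the integral each evaluate \<open>G\<close> at
    one default point; the points may differ, but \<open>G\<close> depends on no coordinate at
    all.\<close>
  have "G (\<lambda>i. real undefined) = G (\<lambda>i. undefined)" by (rule 0) auto
  then show ?case
    by (simp add: PiM_empty lebesgue_integral_count_space_finite)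
next
  case (Suc n)
  interpret P: product_sigma_finite "\<lambda>_::nat. lborel::real measure" ..
  let ?N = "{k. real k \<le> X}" and ?P = "\<Pi>\<^sub>M i\<in>{..<n}. (lborel :: real measure)"
  define E where "E = D * (1 + K * X)"
  have E0: "0 \<le> E" using nonneg by (simp add: E_def)
  have lessThan_insert: "{..<Suc n} = insert n {..<n}" by auto
  \<comment> \<open>\<open>S k\<close> sums over the first \<open>n\<close> coordinates with the
    last one frozen at \<open>k\<close>; \<open>I t\<close> is the corresponding integral with the
    last one frozen at \<open>t\<close>.\<close>
  define S where "S k = (\<Sum>x\<in>{..<n} \<rightarrow>\<^sub>E ?N. of_real (\<Prod>i<n. w i (x i)) * G ((\<lambda>i. real (x i))(n := real k)))"
    for k :: nat
  define I where "I t = (LINT u|?P. of_real (\<Prod>i<n. \<phi> i (u i)) * G (u(n := t)))" for t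
  have [measurable]: "\<phi> i \<in> borel_measurable lborel" if "i \<le> n" for i
    using borel_measurable_integrable[OF Suc.prems(2)[of i]] that by simp
  have G2: "(\<lambda>(u, t). G (u(n := t))) \<in> borel_measurable (?P \<Otimes>\<^sub>M lborel)"
  proof -
    have "(\<lambda>(u, t). u(n := t)) \<in> measurable (?P \<Otimes>\<^sub>M lborel) (\<Pi>\<^sub>M i\<in>insert n {..<n}. lborel)"
      by (rule measurable_add_dim)
    from measurable_compose[OF this, of G borel] show ?thesis
      using Suc.prems(6) by (simp add: lessThan_insert case_prod_beta')
  qed
  have G1 [measurable]: "(\<lambda>u. G (u(n := t))) \<in> borel_measurable ?P" for t
    using measurable_compose[OF _ G2, of "\<lambda>u. (u, t)" ?P] by simp
  have prod_int: "integrable ?P (\<lambda>u. \<Prod>i<n. \<phi> i (u i))"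
    by (rule P.product_integrable_prod) (use Suc.prems(2) in auto)
  have int_I: "integrable ?P (\<lambda>u. of_real (\<Prod>i<n. \<phi> i (u i)) * G (u(n := t)))" for t
  proof (rule Bochner_Integration.integrable_bound[OF prod_int])
    show "(\<lambda>u. of_real (\<Prod>i<n. \<phi> i (u i)) * G (u(n := t))) \<in> borel_measurable ?P"
      using borel_measurable_integrable[OF prod_int] by measurable
    show "AE u in ?P. norm (of_real (\<Prod>i<n. \<phi> i (u i)) * G (u(n := t))) \<le> norm (\<Prod>i<n. \<phi> i (u i))"
      using Suc.prems(8) by (auto simp: norm_mult mult_left_le simp del: of_real_prod)
  qed
  have sum_eq: "(\<Sum>x\<in>{..<Suc n} \<rightarrow>\<^sub>E ?N. of_real (\<Prod>i<Suc n. w i (x i)) * G (\<lambda>i. real (x i)))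
      = (\<Sum>k\<in>?N. of_real (w n k) * S k)"
  proof -
    have "(\<Sum>x\<in>{..<Suc n} \<rightarrow>\<^sub>E ?N. of_real (\<Prod>i<Suc n. w i (x i)) * G (\<lambda>i. real (x i)))
        = (\<Sum>(k, x)\<in>?N \<times> ({..<n} \<rightarrow>\<^sub>E ?N).
            of_real (\<Prod>i<Suc n. w i ((x(n := k)) i)) * G (\<lambda>i. real ((x(n := k)) i)))"
      unfolding lessThan_insert PiE_insert_eq
      using inj_combinator[of n "{..<n}" "\<lambda>_. ?N"]
      by (subst sum.reindex) (auto simp: case_prod_beta')
    also have "\<dots> = (\<Sum>(k, x)\<in>?N \<times> ({..<n} \<rightarrow>\<^sub>E ?N).
        of_real (w n k) * (of_real (\<Prod>i<n. w i (x i)) * G ((\<lambda>i. real (x i))(n := real k))))"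
    proof (intro sum.cong refl, clarify)
      fix k x
      have "(\<lambda>i. real ((x(n := k)) i)) = (\<lambda>i. real (x i))(n := real k)" by auto
      moreover have "(\<Prod>i<Suc n. w i ((x(n := k)) i)) = w n k * (\<Prod>i<n. w i (x i))"
        by (simp add: mult.commute)
      ultimately show "of_real (\<Prod>i<Suc n. w i ((x(n := k)) i)) * G (\<lambda>i. real ((x(n := k)) i))
          = of_real (w n k) * (of_real (\<Prod>i<n. w i (x i)) * G ((\<lambda>i. real (x i))(n := real k)))"
        by (simp only: of_real_mult mult.assoc)
    qed
    also have "\<dots> = (\<Sum>k\<in>?N. of_real (w n k) * S k)"
      by (simp add: S_def sum.cartesian_product sum_distrib_left)
    finally show ?thesis .
  qed
  have IH: "norm (S k - I (real k)) \<le> real n * M ^ (n - 1) * E" if "k \<in> ?N" for k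
  proof -
    have twist: "u(i := t, n := y) = u(n := y, i := t)" if "i < n" for i t y and u :: "nat \<Rightarrow> real"
      using that by (intro fun_upd_twist) simp
    show ?thesis
      unfolding S_def I_def E_def
    proof (rule Suc.IH[where G = "\<lambda>u. G (u(n := real k))" and H = "\<lambda>i u. H i (u(n := real k))"])
      show "((\<lambda>t. G (u(i := t, n := real k))) has_vector_derivative H i (u(i := t, n := real k))) (at t)"
        if "i < n" for i u t
        using Suc.prems(9)[of i "u(n := real k)" t] that by (simp only: twist less_SucI)
      show "continuous_on UNIV (\<lambda>t. H i (u(i := t, n := real k)))" if "i < n" for i u
        using Suc.prems(10)[of i "u(n := real k)"] that by (simp only: twist less_SucI)
      show "norm (H i (u(n := real k))) \<le> K" if "i < n" "\<And>j. j < n \<Longrightarrow> u j \<in> {0..X}" for i u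
        using that \<open>k \<in> ?N\<close> by (intro Suc.prems(11)) (auto simp: less_Suc_eq)
      show "G (u(n := real k)) = G (v(n := real k))" if "\<And>i. i < n \<Longrightarrow> u i = v i" for u v
        using that by (intro Suc.prems(7)) (auto simp: less_Suc_eq)
    qed (use Suc.prems(1-5,8) in auto)
  qed
  have "norm ((\<Sum>k\<in>?N. of_real (w n k) * S k) - (\<Sum>k\<in>?N. of_real (w n k) * I (real k)))
      = norm (\<Sum>k\<in>?N. of_real (w n k) * (S k - I (real k)))"
    by (simp add: sum_subtractf right_diff_distrib)
  also have "\<dots> \<le> (\<Sum>k\<in>?N. \<bar>w n k\<bar> * (real n * M ^ (n - 1) * E))"
    by (rule sum_norm_le) (use IH in \<open>auto simp: norm_mult intro!: mult_left_mono\<close>)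
  also have "\<dots> = (\<Sum>k\<in>?N. \<bar>w n k\<bar>) * (real n * M ^ (n - 1) * E)"
    by (simp add: sum_distrib_right)
  also have "\<dots> \<le> M * (real n * M ^ (n - 1) * E)"
    using Suc.prems(1)[of n] nonneg E0 by (intro mult_right_mono) auto
  \<comment> \<open>For \<open>n = 0\<close> both sides vanish, so the truncated exponent
    \<open>n - 1\<close> does no harm.\<close>
  also have "\<dots> = real n * M ^ n * E"
    by (cases n) auto
  finally have part1: "norm ((\<Sum>k\<in>?N. of_real (w n k) * S k) - (\<Sum>k\<in>?N. of_real (w n k) * I (real k)))
      \<le> real n * M ^ n * E" .
  \<comment> \<open>For fixed first coordinates, \<open>T\<close> and \<open>J\<close> are the sum
    and the integral over the last one; it remains to exchange \<open>T\<close> for \<open>J\<close>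
    under the integral over the others.\<close>
  define T where "T u = (\<Sum>k\<in>?N. of_real (w n k) * G (u(n := real k)))" for u
  define J where "J u = (LINT t|lborel. of_real (\<phi> n t) * G (u(n := t)))" for u
  have \<phi>nG: "(\<lambda>(u, t). of_real (\<phi> n t) * G (u(n := t))) \<in> borel_measurable (?P \<Otimes>\<^sub>M lborel)"
    using G2 by (simp add: case_prod_beta')
  have [measurable]: "T \<in> borel_measurable ?P" unfolding T_def by measurable
  have [measurable]: "J \<in> borel_measurable ?P"
    unfolding J_def using \<phi>nG by (rule lborel.borel_measurable_lebesgue_integral)
  have TI: "(\<Sum>k\<in>?N. of_real (w n k) * I (real k)) = (LINT u|?P. of_real (\<Prod>i<n. \<phi> i (u i)) * T u)"
  proof -
    have "(LINT u|?P. of_real (\<Prod>i<n. \<phi> i (u i)) * T u)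
        = (LINT u|?P. (\<Sum>k\<in>?N. of_real (w n k) * (of_real (\<Prod>i<n. \<phi> i (u i)) * G (u(n := real k)))))"
      by (simp add: T_def sum_distrib_left mult_ac)
    also have "\<dots> = (\<Sum>k\<in>?N. of_real (w n k) * I (real k))"
      unfolding I_def using int_I
      by (subst Bochner_Integration.integral_sum) (auto simp del: of_real_prod)
    finally show ?thesis ..
  qed
  have intT: "integrable ?P (\<lambda>u. of_real (\<Prod>i<n. \<phi> i (u i)) * T u)"
  proof -
    have "integrable ?P (\<lambda>u. (\<Sum>k\<in>?N. of_real (w n k) * (of_real (\<Prod>i<n. \<phi> i (u i)) * G (u(n := real k)))))"
      using int_I by (intro Bochner_Integration.integrable_sum integrable_mult_right)
    then show ?thesis by (simp add: T_def sum_distrib_left mult_ac)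
  qed
  have J_le: "norm (J u) \<le> M" for u
  proof -
    have "norm (J u) \<le> (LINT t|lborel. norm (of_real (\<phi> n t) * G (u(n := t))))"
      unfolding J_def by (rule integral_norm_bound)
    also have "\<dots> \<le> (LINT t|lborel. \<bar>\<phi> n t\<bar>)"
      using Suc.prems(2)[of n] Suc.prems(8)
      by (intro Bochner_Integration.integral_mono') (auto simp: norm_mult mult_left_le)
    also have "\<dots> \<le> M" using Suc.prems(4)[of n] by simp
    finally show ?thesis .
  qed
  have intJ: "integrable ?P (\<lambda>u. of_real (\<Prod>i<n. \<phi> i (u i)) * J u)"
  proof (rule Bochner_Integration.integrable_bound)
    show "integrable ?P (\<lambda>u. (\<Prod>i<n. \<phi> i (u i)) * M)"
      using prod_int by simp
    show "(\<lambda>u. of_real (\<Prod>i<n. \<phi> i (u i)) * J u) \<in> borel_measurable ?P"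
      using borel_measurable_integrable[OF prod_int] by measurable
    show "AE u in ?P. norm (of_real (\<Prod>i<n. \<phi> i (u i)) * J u) \<le> norm ((\<Prod>i<n. \<phi> i (u i)) * M)"
      using J_le nonneg by (auto simp: norm_mult abs_mult simp del: of_real_prod intro!: mult_left_mono)
  qed
  have int_full: "integrable (\<Pi>\<^sub>M i\<in>insert n {..<n}. lborel)
      (\<lambda>u. of_real (\<Prod>i<Suc n. \<phi> i (u i)) * G u)"
  proof (rule Bochner_Integration.integrable_bound)
    show *: "integrable (\<Pi>\<^sub>M i\<in>insert n {..<n}. lborel) (\<lambda>u. \<Prod>i<Suc n. \<phi> i (u i))"
      unfolding lessThan_insert
      by (rule P.product_integrable_prod) (use Suc.prems(2) in auto)
    show "(\<lambda>u. of_real (\<Prod>i<Suc n. \<phi> i (u i)) * G u) \<in> borel_measurable (\<Pi>\<^sub>M i\<in>insert n {..<n}. lborel)"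
      using borel_measurable_integrable[OF *] Suc.prems(6) unfolding lessThan_insert by measurable
    show "AE u in (\<Pi>\<^sub>M i\<in>insert n {..<n}. lborel).
        norm (of_real (\<Prod>i<Suc n. \<phi> i (u i)) * G u) \<le> norm (\<Prod>i<Suc n. \<phi> i (u i))"
      using Suc.prems(8) by (auto simp: norm_mult mult_left_le simp del: of_real_prod prod.lessThan_Suc)
  qed
  have full: "(LINT u|(\<Pi>\<^sub>M i\<in>{..<Suc n}. lborel). of_real (\<Prod>i<Suc n. \<phi> i (u i)) * G u)
      = (LINT u|?P. of_real (\<Prod>i<n. \<phi> i (u i)) * J u)"
  proof -
    have "(LINT u|(\<Pi>\<^sub>M i\<in>{..<Suc n}. lborel). of_real (\<Prod>i<Suc n. \<phi> i (u i)) * G u)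
        = (LINT u|?P. LINT t|lborel. of_real (\<Prod>i<Suc n. \<phi> i ((u(n := t)) i)) * G (u(n := t)))"
      using P.product_integral_insert[OF _ _ int_full] by (simp add: lessThan_insert)
    also have "\<dots> = (LINT u|?P. LINT t|lborel. of_real (\<Prod>i<n. \<phi> i (u i)) * (of_real (\<phi> n t) * G (u(n := t))))"
      by (simp add: mult.assoc)
    also have "\<dots> = (LINT u|?P. of_real (\<Prod>i<n. \<phi> i (u i)) * J u)"
      by (simp only: integral_mult_right_zero J_def)
    finally show ?thesis .
  qed
  \<comment> \<open>The bound \<open>K\<close> on the derivative holds only inside the box; outside
    it some factor of the product vanishes, so nothing has to be shown there.\<close>
  have TJ: "norm (of_real (\<Prod>i<n. \<phi> i (u i)) * (T u - J u)) \<le> (\<Prod>i<n. \<bar>\<phi> i (u i)\<bar>) * E" for u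
  proof (cases "\<forall>i<n. u i \<in> {0..X}")
    case True
    have "norm (T u - J u) \<le> E"
      unfolding T_def J_def E_def
    proof (rule partial_summation_discrepancy[where g' = "\<lambda>t. H n (u(n := t))"])
      show "norm (H n (u(n := t))) \<le> K" if "t \<in> {0..X}" for t
        using that True by (intro Suc.prems(11)) (auto simp: less_Suc_eq)
    qed (use nonneg Suc.prems(8) Suc.prems(2,3,5,9,10)[OF lessI] in \<open>auto simp del: fun_upd_apply\<close>)
    then show ?thesis
      by (auto simp: norm_mult abs_prod simp del: of_real_prod intro!: mult_left_mono prod_nonneg)
  next
    case False
    then obtain i where "i < n" "u i \<notin> {0..X}" by blast
    then have "i < n" "\<phi> i (u i) = 0" using Suc.prems(3)[of i "u i"] by simp_all
    then have "(\<Prod>i<n. \<phi> i (u i)) = 0" "(\<Prod>i<n. \<bar>\<phi> i (u i)\<bar>) = 0" by (auto intro!: prod_zero)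
    then show ?thesis by (simp only: of_real_0 mult_zero_left norm_zero order_refl)
  qed
  have "norm ((LINT u|?P. of_real (\<Prod>i<n. \<phi> i (u i)) * T u) - (LINT u|?P. of_real (\<Prod>i<n. \<phi> i (u i)) * J u))
      = norm (LINT u|?P. of_real (\<Prod>i<n. \<phi> i (u i)) * (T u - J u))"
    by (subst Bochner_Integration.integral_diff[OF intT intJ, symmetric]) (simp only: right_diff_distrib)
  also have "\<dots> \<le> (LINT u|?P. norm (of_real (\<Prod>i<n. \<phi> i (u i)) * (T u - J u)))"
    by (rule integral_norm_bound)
  also have "\<dots> \<le> (LINT u|?P. (\<Prod>i<n. \<bar>\<phi> i (u i)\<bar>) * E)"
  proof (rule Bochner_Integration.integral_mono)
    show "integrable ?P (\<lambda>u. norm (of_real (\<Prod>i<n. \<phi> i (u i)) * (T u - J u)))"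
      using integrable_norm[OF Bochner_Integration.integrable_diff[OF intT intJ]]
      by (simp only: right_diff_distrib)
    show "integrable ?P (\<lambda>u. (\<Prod>i<n. \<bar>\<phi> i (u i)\<bar>) * E)"
      using integrable_abs[OF prod_int] by (simp add: abs_prod)
  qed (rule TJ)
  also have "\<dots> = (\<Prod>i<n. LINT t|lborel. \<bar>\<phi> i t\<bar>) * E"
    using Suc.prems(2) by (subst P.product_integral_prod[symmetric]) auto
  also have "\<dots> \<le> (\<Prod>i<n. M) * E"
    using Suc.prems(4) E0 by (intro mult_right_mono prod_mono) auto
  finally have part2: "norm ((LINT u|?P. of_real (\<Prod>i<n. \<phi> i (u i)) * T u)
      - (LINT u|?P. of_real (\<Prod>i<n. \<phi> i (u i)) * J u)) \<le> M ^ n * E"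
    by simp
  \<comment> \<open>The cost of the first \<open>n\<close> coordinates plus that of the last
    one.\<close>
  have "real n * M ^ n * E + M ^ n * E = real (Suc n) * M ^ (Suc n - 1) * E"
    by (simp add: algebra_simps)
  then show ?case
    unfolding sum_eq full E_def[symmetric]
    using norm_diff_triangle_le[OF part1[unfolded TI] part2] by (simp only:)
qed

section \<open>Residue classes\<close>

lemma norm_e [simp]: "norm (e z) = 1"
proof -
  have "e z = exp (\<i> * of_real (2 * pi * z))" by (simp add: e_def mult_ac)
  then show ?thesis by (simp only: norm_exp_i_times)
qed

lemma e_add: "e (x + y) = e x * e y"
  by (simp add: e_def exp_add[symmetric] algebra_simps)

lemma e_of_int [simp]: "e (of_int k) = 1"
proof -
  have "e (of_int k) = exp (2 * of_int k * of_real pi * \<i>)" by (simp add: e_def mult_ac)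
  then show ?thesis using exp_integer_2pi[of "of_int k"] by simp
qed

section \<open>The quadratic form and its phase along coordinate lines\<close>

lemma qform_cong:
  assumes "\<And>i. i < s \<Longrightarrow> u i = v i"
  shows "qform s c u = qform s c v"
  unfolding qform_def using assms by (intro sum.cong refl) auto

text \<open>The partial derivative in variable \<open>k\<close>, monomial by monomial. For
  \<open>i = j = k\<close> both alternatives apply and give the \<open>2 * u k\<close> of a
  square.\<close>

definition qform_deriv :: "nat \<Rightarrow> (nat \<Rightarrow> nat \<Rightarrow> int) \<Rightarrow> nat \<Rightarrow> (nat \<Rightarrow> real) \<Rightarrow> real" where
  "qform_deriv s c k u = (\<Sum>i<s. \<Sum>j\<le>i. of_int (c i j) *
     ((if i = k then u j else 0) + (if j = k then u i else 0)))"

lemma qform_has_derivative: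
  "((\<lambda>t. qform s c (u(k := t))) has_real_derivative qform_deriv s c k (u(k := t))) (at t)"
proof -
  have 1: "((\<lambda>t. (u(k := t)) i) has_real_derivative (if i = k then 1 else 0)) (at t)" for i
    by (cases "i = k") auto
  have "((\<lambda>t. \<Sum>i<s. \<Sum>j\<le>i. of_int (c i j) * ((u(k := t)) i * (u(k := t)) j)) has_real_derivative
     (\<Sum>i<s. \<Sum>j\<le>i. of_int (c i j) * ((if i = k then 1 else 0) * (u(k := t)) j
        + (if j = k then 1 else 0) * (u(k := t)) i))) (at t)"
    by (intro DERIV_sum DERIV_cmult DERIV_mult 1)
  moreover have "(\<Sum>i<s. \<Sum>j\<le>i. of_int (c i j) * ((if i = k then 1 else 0) * (u(k := t)) j
        + (if j = k then 1 else 0) * (u(k := t)) i)) = qform_deriv s c k (u(k := t))"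
    unfolding qform_deriv_def by (intro sum.cong refl) auto
  ultimately show ?thesis by (simp only: qform_def mult.assoc)
qed

lemma continuous_qform_deriv: "continuous_on UNIV (\<lambda>t. qform_deriv s c k (u(k := t)))"
proof -
  have "continuous_on UNIV (\<lambda>t. (u(k := t)) i)" for i
    by (cases "i = k") auto
  then have "continuous_on UNIV (\<lambda>t. if i = k then (u(k := t)) j else 0)" for i j
    by (cases "i = k") auto
  then show ?thesis
    unfolding qform_deriv_def by (intro continuous_intros)
qed

text \<open>On the box each monomial contributes at most its coefficient times \<open>2 * X\<close>;
  the 2 is needed for squares.\<close>

lemma qform_deriv_le:
  assumes "0 \<le> X" "\<And>j. j < s \<Longrightarrow> u j \<in> {0..X}"
  shows "\<bar>qform_deriv s c k u\<bar> \<le> (\<Sum>i<s. \<Sum>j\<le>i. of_int \<bar>c i j\<bar>) * (2 * X)"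
  unfolding qform_deriv_def sum_distrib_right
proof (intro sum_abs[THEN order_trans] sum_mono)
  fix i j assume ij: "i \<in> {..<s}" "j \<in> {..i}"
  then have "u i \<in> {0..X}" "u j \<in> {0..X}" using assms(2) by auto
  then have "\<bar>(if i = k then u j else 0) + (if j = k then u i else 0)\<bar> \<le> 2 * X" by auto
  then show "\<bar>of_int (c i j) * ((if i = k then u j else 0) + (if j = k then u i else 0))\<bar>
      \<le> of_int \<bar>c i j\<bar> * (2 * X)"
    unfolding abs_mult of_int_abs by (intro mult_left_mono) auto
qed

lemma e_qform_has_derivative:
  "((\<lambda>t. e (lam * qform s c (u(k := t)))) has_vector_derivative
     of_real (2 * pi * lam * qform_deriv s c k (u(k := t))) * \<i> * e (lam * qform s c (u(k := t)))) (at t)"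
proof -
  let ?f = "\<lambda>t. lam * qform s c (u(k := t))" and ?d = "lam * qform_deriv s c k (u(k := t))"
  have "(?f has_real_derivative ?d) (at t)"
    by (intro DERIV_cmult qform_has_derivative)
  then have "((\<lambda>t. 2 * of_real pi * \<i> * of_real (?f t)) has_vector_derivative 2 * of_real pi * \<i> * of_real ?d) (at t)"
    by (intro has_vector_derivative_mult_right has_vector_derivative_of_real)
  from field_vector_diff_chain_at[OF this DERIV_exp] show ?thesis
    unfolding o_def e_def by (simp only: of_real_mult of_real_numeral mult_ac)
qed

lemma qform_measurable [measurable]:
  "qform s c \<in> borel_measurable (\<Pi>\<^sub>M i\<in>{..<s}. lborel)"
proof -
  have "(\<lambda>u. of_int (c i j) * u i * u j :: real) \<in> borel_measurable (\<Pi>\<^sub>M i\<in>{..<s}. lborel)"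
    if "i < s" "j \<le> i" for i j
  proof -
    have *: "(\<lambda>u. u k) \<in> borel_measurable (\<Pi>\<^sub>M i\<in>{..<s}. lborel :: real measure)" if "k < s" for k
      using measurable_component_singleton[of k "{..<s}" "\<lambda>_. lborel :: real measure"] that by simp
    show ?thesis by (intro borel_measurable_times borel_measurable_const *) (use that in auto)
  qed
  then show ?thesis
    unfolding qform_def[abs_def] by (intro borel_measurable_sum) auto
qed

lemma measurable_e [measurable]: "e \<in> borel_measurable borel"
  unfolding e_def[abs_def] by (intro borel_measurable_continuous_onI continuous_intros)

section \<open>Reduction modulo \<open>q\<close>\<close>

lemma qform_of_nat: "qform s c (\<lambda>i. real (x i)) = of_int (\<Sum>i<s. \<Sum>j\<le>i. c i j * int (x i) * int (x j))"
  by (simp add: qform_def)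

text \<open>The coefficients are integers, so reducing the variables modulo \<open>q\<close> changes
  the form by a multiple of \<open>q\<close>, hence the phase by an integer.\<close>

lemma e_qform_mod:
  assumes "q \<ge> 1"
    and x: "\<And>i. i < s \<Longrightarrow> x i mod q = h i"
  shows "e (real b / real q * qform s c (\<lambda>i. real (x i))) = e (real b / real q * qform s c (\<lambda>i. real (h i)))"
proof -
  let ?f = "\<lambda>x. \<Sum>i<s. \<Sum>j\<le>i. c i j * int (x i) * int (x j)"
  have "[?f x = ?f h] (mod int q)"
  proof (intro cong_sum cong_mult cong_refl)
    fix i j assume "i \<in> {..<s}" "j \<in> {..i}"
    then have "h i = x i mod q" "h j = x j mod q" using x by auto
    then show "[int (x i) = int (h i)] (mod int q)" "[int (x j) = int (h j)] (mod int q)"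
      by (simp_all add: cong_def zmod_int)
  qed
  then obtain k where k: "?f x = ?f h + int q * k"
    using cong_iff_lin[THEN iffD1, OF cong_sym] by blast
  have "real b / real q * of_int (N + int q * k) = of_int (int b * k) + real b / real q * of_int N" for N
    using assms(1) by (simp add: field_simps)
  then show ?thesis by (simp only: qform_of_nat k e_add e_of_int mult_1)
qed

text \<open>Every point \<open>x\<close> lies in exactly one class \<open>h\<close>, and up to an
  integer its phase is the rational part at \<open>h\<close> plus \<open>lam\<close> times the form
  at \<open>x\<close>. The congruence conditions sit in the weights, so all classes share one box
  and the weights remain products over the coordinates.\<close>

lemma exp_sum_residues:
  assumes q: "q \<ge> 1" and \<alpha>: "\<alpha> = real b / real q + lam"
  shows "exp_sum s c a X \<alpha> = (\<Sum>h\<in>{..<s} \<rightarrow>\<^sub>E {..<q}. e (real b / real q * qform s c (\<lambda>i. real (h i))) *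
    (\<Sum>x\<in>{..<s} \<rightarrow>\<^sub>E {n. real n \<le> X}. of_real (\<Prod>i<s. if x i mod q = h i then a (x i) else 0) *
       e (lam * qform s c (\<lambda>i. real (x i)))))"
proof -
  let ?H = "{..<s} \<rightarrow>\<^sub>E {..<q}" and ?B = "{..<s} \<rightarrow>\<^sub>E {n::nat. real n \<le> X}"
  let ?f = "\<lambda>x. qform s c (\<lambda>i. real (x i :: nat))"
  have finH: "finite ?H" by (intro finite_PiE) auto
  have "(\<Sum>h\<in>?H. e (real b / real q * ?f h) *
      (of_real (\<Prod>i<s. if x i mod q = h i then a (x i) else 0) * e (lam * ?f x)))
      = of_real (\<Prod>i<s. a (x i)) * e (\<alpha> * ?f x)" for x :: "nat \<Rightarrow> nat"
  proof -
    \<comment> \<open>The class of \<open>x\<close>; \<open>restrict\<close> gives it the default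
      value outside \<open>{..<s}\<close> that membership in the index set demands.\<close>
    define h0 where "h0 = restrict (\<lambda>i. x i mod q) {..<s}"
    have h0: "h0 \<in> ?H" using q by (auto simp: h0_def)
    have "(\<Sum>h\<in>?H. e (real b / real q * ?f h) *
        (of_real (\<Prod>i<s. if x i mod q = h i then a (x i) else 0) * e (lam * ?f x)))
        = (\<Sum>h\<in>?H. if h = h0 then e (real b / real q * ?f h0) * (of_real (\<Prod>i<s. a (x i)) * e (lam * ?f x)) else 0)"
    proof (rule sum.cong[OF refl])
      fix h assume h: "h \<in> ?H"
      show "e (real b / real q * ?f h) * (of_real (\<Prod>i<s. if x i mod q = h i then a (x i) else 0) * e (lam * ?f x))
        = (if h = h0 then e (real b / real q * ?f h0) * (of_real (\<Prod>i<s. a (x i)) * e (lam * ?f x)) else 0)"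
      proof (cases "h = h0")
        case True
        have "(\<Prod>i<s. if x i mod q = h i then a (x i) else 0) = (\<Prod>i<s. a (x i))"
          by (intro prod.cong) (auto simp: True h0_def)
        then show ?thesis using True by simp
      next
        case False
        then obtain i where i: "i < s" "h i \<noteq> h0 i"
          using PiE_ext[OF h h0] by auto
        then have "(\<Prod>i<s. if x i mod q = h i then a (x i) else 0) = 0"
          by (intro prod_zero bexI[of _ i]) (auto simp: h0_def)
        then show ?thesis using False by (simp only: of_real_0 mult_zero_left mult_zero_right if_False)
      qed
    qed
    also have "\<dots> = e (real b / real q * ?f h0) * (of_real (\<Prod>i<s. a (x i)) * e (lam * ?f x))"
      by (simp only: sum.delta[OF finH] h0 if_True)
    also have "e (real b / real q * ?f h0) = e (real b / real q * ?f x)"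
      using q by (intro e_qform_mod[symmetric]) (auto simp: h0_def)
    finally show ?thesis by (simp add: \<alpha> e_add distrib_right)
  qed
  then show ?thesis
    unfolding exp_sum_def sum_distrib_left by (subst sum.swap) (simp only:)
qed

text \<open>Moves the densities and the box indicator into the one-variable factors, the shape in
  which the sum over one class is compared with an integral.\<close>

lemma kappa_sing_int:
  "of_real (\<Prod>i<s. k i) * sing_int s c \<psi> lam X
    = (LINT u|(\<Pi>\<^sub>M i\<in>{..<s}. lborel).
        of_real (\<Prod>i<s. k i * (indicator {0..X} (u i) * \<psi> (u i))) * e (lam * qform s c u))"
  unfolding sing_int_def set_lebesgue_integral_def integral_mult_right_zero[symmetric]
proof (rule Bochner_Integration.integral_cong[OF refl])
  fix u :: "nat \<Rightarrow> real" assume "u \<in> space (\<Pi>\<^sub>M i\<in>{..<s}. lborel)"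
  \<comment> \<open>Points of the product space already take the default value off
    \<open>{..<s}\<close>, so lying in the box is a condition on the first \<open>s\<close>
    coordinates alone.\<close>
  then have u: "u \<in> extensional {..<s}" by (auto simp: space_PiM PiE_def)
  have "indicator ({..<s} \<rightarrow>\<^sub>E {0..X}) u = (\<Prod>i<s. indicator {0..X} (u i) :: real)"
  proof (cases "u \<in> {..<s} \<rightarrow>\<^sub>E {0..X}")
    case True
    then have "u i \<in> {0..X}" if "i < s" for i using PiE_mem[of u "{..<s}" "\<lambda>_. {0..X}" i] that by simp
    then have "(\<Prod>i<s. indicator {0..X} (u i) :: real) = 1" by (intro prod.neutral) simp
    then show ?thesis using True by simp
  next
    case False
    then obtain i where "i < s" "u i \<notin> {0..X}" using u unfolding PiE_iff by blast
    then have "(\<Prod>i<s. indicator {0..X} (u i) :: real) = 0" by (intro prod_zero bexI[of _ i]) auto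
    then show ?thesis using False by simp
  qed
  then show "of_real (\<Prod>i<s. k i) * (indicator ({..<s} \<rightarrow>\<^sub>E {0..X}) u *\<^sub>R
      (of_real (\<Prod>i<s. \<psi> (u i)) * e (lam * qform s c u)))
    = of_real (\<Prod>i<s. k i * (indicator {0..X} (u i) * \<psi> (u i))) * e (lam * qform s c u)"
    by (simp only: prod.distrib of_real_mult scaleR_conv_of_real mult_ac)
qed

section \<open>Uniform discrepancy\<close>

lemma finite_pos_nat_le_real [simp]: "finite {n::nat. Suc 0 \<le> n \<and> real n \<le> t}"
  by (rule finite_subset[OF _ finite_nat_le_real[of t]]) auto

lemma A_mono:
  assumes "\<And>x. a x \<ge> 0" "X \<le> Y"
  shows "A a X \<le> A a Y"
  unfolding A_def using assms by (intro sum_mono2) auto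

lemma A_nonneg: "(\<And>x. a x \<ge> 0) \<Longrightarrow> A a X \<ge> 0"
  unfolding A_def by (intro sum_nonneg) auto

lemma A_res_nonneg: "(\<And>x. a x \<ge> 0) \<Longrightarrow> A_res a q h X \<ge> 0"
  unfolding A_res_def by (intro sum_nonneg) auto

lemma A_res_le_A:
  assumes "\<And>x. a x \<ge> 0"
  shows "A_res a q h X \<le> A a X"
  unfolding A_def A_res_def using assms by (intro sum_mono2) auto

text \<open>A non-zero weight at some \<open>x \<ge> 1\<close> is counted by \<open>A a X\<close> as
  soon as \<open>X \<ge> x\<close>.\<close>

lemma eventually_A_pos:
  assumes "\<And>x. a x \<ge> 0" "\<exists>x\<ge>1. a x \<noteq> 0"
  shows "\<forall>\<^sub>F X in at_top. A a X > 0"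
proof -
  obtain x where x: "x \<ge> 1" "a x \<noteq> 0" using assms(2) by blast
  have "A a X > 0" if "X \<ge> real x" for X
  proof -
    have "0 < a x" using assms(1)[of x] x by simp
    also have "a x \<le> A a X"
      unfolding A_def using x that assms(1) by (intro member_le_sum) auto
    finally show ?thesis .
  qed
  then show ?thesis unfolding eventually_at_top_linorder by blast
qed

section \<open>Growth and primitive of a smooth approximation\<close>

lemma smooth_approx_has_derivative:
  assumes "smooth_approx a m \<Psi>" "X > 0"
  shows "(\<Psi> has_real_derivative deriv \<Psi> X) (at X)"
  using assms unfolding smooth_approx_def smooth_on_pos_def DERIV_deriv_iff_field_differentiable
  by (metis funpow_0)

text \<open>Since \<open>\<psi>(X) \<ge> c A(X)/X \<ge> (c/2) \<Psi>(X)/X\<close>, the function \<open>\<Psi>(X) X\<^sup>-\<^sup>\<delta>\<close> with \<open>\<delta> = c/2\<close> is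
  eventually non-decreasing, so that \<open>A\<close> grows at least like a power.\<close>

lemma smooth_approx_growth:
  assumes a: "\<And>x. a x \<ge> 0" "\<exists>x\<ge>1. a x \<noteq> 0" and m: "m > 0" and \<Psi>: "smooth_approx a m \<Psi>"
  obtains T K \<delta> where "T \<ge> exp 1" "\<delta> > 0" "K \<ge> 0" "A a T > 0"
    "\<And>X. X \<ge> T \<Longrightarrow> deriv \<Psi> X \<ge> 0"
    "\<And>X. X \<ge> T \<Longrightarrow> \<bar>\<Psi> X - A a X\<bar> \<le> K * (A a X / ln X ^ m)"
    "\<And>X. X \<ge> T \<Longrightarrow> \<Psi> X \<le> 2 * A a X"
    "\<And>X Y. T \<le> X \<Longrightarrow> X \<le> Y \<Longrightarrow> A a X * Y powr \<delta> \<le> 4 * A a Y * X powr \<delta>"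
proof -
  have A0: "A a X \<ge> 0" for X using a(1) by (rule A_nonneg)
  have "(\<lambda>X. \<Psi> X - A a X) \<in> O[at_top](\<lambda>X. A a X / ln X ^ m)"
    using \<Psi> unfolding smooth_approx_def by blast
  then obtain K where K: "K > 0" "\<forall>\<^sub>F X in at_top. norm (\<Psi> X - A a X) \<le> K * norm (A a X / ln X ^ m)"
    by (rule landau_o.bigE)
  obtain c1 c2 where c1: "c1 > 0" "\<forall>\<^sub>F X in at_top. c1 * (A a X / X) \<le> deriv \<Psi> X \<and> deriv \<Psi> X \<le> c2 * (A a X / X)"
    using \<Psi> unfolding smooth_approx_def by blast
  have "filterlim (\<lambda>X::real. ln X ^ m) at_top at_top"
    using m by (intro filterlim_pow_at_top ln_at_top) auto
  \<comment> \<open>From here on the approximation error is at most half of \<open>A a X\<close>;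
    this uses \<open>m > 0\<close>.\<close>
  then have ev: "\<forall>\<^sub>F X::real in at_top. ln X ^ m \<ge> 2 * K"
    unfolding filterlim_at_top by blast
  obtain T where T: "\<And>X. X \<ge> T \<Longrightarrow> norm (\<Psi> X - A a X) \<le> K * norm (A a X / ln X ^ m) \<and>
      c1 * (A a X / X) \<le> deriv \<Psi> X \<and> ln X ^ m \<ge> 2 * K \<and> A a X > 0 \<and> X \<ge> exp 1"
    using eventually_conj[OF K(2) eventually_conj[OF c1(2) eventually_conj[OF ev
      eventually_conj[OF eventually_A_pos[OF a] eventually_ge_at_top[of "exp 1"]]]]]
    unfolding eventually_at_top_linorder by blast
  have pos: "X > 0" if "X \<ge> T" for X
    using T[OF that] by (meson exp_gt_zero less_le_trans)
  have ln1: "ln X \<ge> 1" if "X \<ge> T" for X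
    using T[OF that] pos[OF that] by (simp add: ln_ge_iff)
  have close: "\<bar>\<Psi> X - A a X\<bar> \<le> K * (A a X / ln X ^ m)" if "X \<ge> T" for X
    using T[OF that] A0[of X] ln1[OF that] by simp
  have half: "\<bar>\<Psi> X - A a X\<bar> \<le> A a X / 2" if "X \<ge> T" for X
  proof -
    have "K * (A a X / ln X ^ m) = A a X * (K / ln X ^ m)" by simp
    also have "\<dots> \<le> A a X * (1 / 2)"
      using T[OF that] K(1) A0[of X] by (intro mult_left_mono) (auto simp: divide_le_eq)
    finally show ?thesis using close[OF that] by linarith
  qed
  have lower: "c1 / 2 * (\<Psi> X / X) \<le> deriv \<Psi> X" if "X \<ge> T" for X
  proof -
    have "\<Psi> X \<le> 2 * A a X" using half[OF that] A0[of X] by linarith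
    then have "c1 / 2 * (\<Psi> X / X) \<le> c1 / 2 * (2 * A a X / X)"
      using pos[OF that] c1(1) by (intro mult_left_mono divide_right_mono) auto
    then show ?thesis using T[OF that] by simp
  qed
  note \<Psi>_deriv = smooth_approx_has_derivative[OF \<Psi>]
  show ?thesis
  \<comment> \<open>The exponent is half of the lower constant \<open>c1\<close>, because
    \<open>\<Psi>\<close> may be twice as large as \<open>A\<close>.\<close>
  proof (rule that[of T "c1 / 2" K])
    show "deriv \<Psi> X \<ge> 0" if "X \<ge> T" for X
    proof -
      have "0 \<le> c1 * (A a X / X)" using c1(1) A0[of X] pos[OF that] by simp
      then show ?thesis using T[OF that] by linarith
    qed
    show "\<Psi> X \<le> 2 * A a X" if "X \<ge> T" for X
      using half[OF that] A0[of X] by linarith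
    show "A a X * Y powr (c1 / 2) \<le> 4 * A a Y * X powr (c1 / 2)" if "T \<le> X" "X \<le> Y" for X Y
    proof -
      let ?d = "c1 / 2"
      \<comment> \<open>The derivative of this quotient has the sign of
        \<open>deriv \<Psi> x - ?d * (\<Psi> x / x)\<close>, which \<open>lower\<close> makes
        non-negative.\<close>
      have "\<Psi> X * X powr (- ?d) \<le> \<Psi> Y * Y powr (- ?d)"
      proof (rule DERIV_nonneg_imp_nondecreasing[OF \<open>X \<le> Y\<close>])
        fix x assume "X \<le> x" "x \<le> Y"
        then have x: "x \<ge> T" "x > 0" using that pos[of x] by auto
        have "((\<lambda>x. \<Psi> x * x powr (- ?d)) has_real_derivative
            (deriv \<Psi> x - ?d * (\<Psi> x / x)) * x powr (- ?d)) (at x)"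
          using DERIV_mult[OF \<Psi>_deriv[OF x(2)] has_real_derivative_powr[OF x(2), of "- ?d"]] x(2)
          by (simp add: powr_diff algebra_simps)
        moreover have "(deriv \<Psi> x - ?d * (\<Psi> x / x)) * x powr (- ?d) \<ge> 0"
          using lower[OF x(1)] by simp
        ultimately show "\<exists>y. ((\<lambda>x. \<Psi> x * x powr (- ?d)) has_real_derivative y) (at x) \<and> 0 \<le> y"
          by blast
      qed
      then have "\<Psi> X * Y powr ?d \<le> \<Psi> Y * X powr ?d"
        using pos[of X] pos[of Y] that by (simp add: powr_minus field_simps)
      \<comment> \<open>Passing between \<open>\<Psi>\<close> and \<open>A\<close> costs a factor 2
        at each end, whence the 4.\<close>
      moreover have "A a X \<le> 2 * \<Psi> X" "\<Psi> Y \<le> 2 * A a Y"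
        using half[of X] half[of Y] that A0[of X] A0[of Y] by linarith+
      then have "A a X * Y powr ?d \<le> 2 * (\<Psi> X * Y powr ?d)" "2 * (\<Psi> Y * X powr ?d) \<le> 2 * (2 * A a Y * X powr ?d)"
        using mult_right_mono[of "A a X" "2 * \<Psi> X" "Y powr ?d"]
          mult_right_mono[of "\<Psi> Y" "2 * A a Y" "X powr ?d"] by simp_all
      ultimately show ?thesis by linarith
    qed
    show "T \<ge> exp 1" "A a T > 0" using T[of T] by blast+
    show "\<bar>\<Psi> X - A a X\<bar> \<le> K * (A a X / ln X ^ m)" if "X \<ge> T" for X by (rule close[OF that])
  qed (use c1 K in simp_all)
qed

text \<open>From \<open>T\<close> on \<open>deriv \<Psi>\<close> is non-negative, so its absolute
  integral over [T,t] is just the increment of \<open>\<Psi>\<close>. What happens before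
  \<open>T\<close> contributes a constant.\<close>

lemma smooth_approx_primitive:
  assumes a: "\<And>x. a x \<ge> 0" and \<Psi>: "smooth_approx a m \<Psi>" and T: "T > 0"
    and \<psi>0: "\<And>X. X \<ge> T \<Longrightarrow> deriv \<Psi> X \<ge> 0" and le: "\<And>X. X \<ge> T \<Longrightarrow> \<Psi> X \<le> 2 * A a X"
  obtains K where "K \<ge> 0"
    "\<And>t. t > 0 \<Longrightarrow> (LINT u:{0..t}|lborel. \<bar>deriv \<Psi> u\<bar>) \<le> K + 2 * A a t"
    "\<And>t. t \<ge> T \<Longrightarrow> \<bar>(LINT u:{0..t}|lborel. deriv \<Psi> u) - \<Psi> t\<bar> \<le> K"
proof -
  let ?\<psi> = "deriv \<Psi>"
  have A0: "A a X \<ge> 0" for X using a by (rule A_nonneg)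
  have int: "set_integrable lborel {0..t} ?\<psi>" if "t > 0" for t
    using \<Psi> that unfolding smooth_approx_def by blast
  note int_abs = set_integrable_abs[OF int]
  \<comment> \<open>Lebesgue integrals are read as gauge integrals, for which the fundamental
    theorem and the splitting of intervals are applied.\<close>
  note HK = set_borel_integral_eq_integral(1)[OF int] set_borel_integral_eq_integral(2)[OF int]
  note HK_abs = set_borel_integral_eq_integral(1)[OF int_abs] set_borel_integral_eq_integral(2)[OF int_abs]
  note \<Psi>_deriv = smooth_approx_has_derivative[OF \<Psi>]
  have ftc: "integral {T..t} ?\<psi> = \<Psi> t - \<Psi> T" if "t \<ge> T" for t
  proof (intro integral_unique fundamental_theorem_of_calculus that)
    fix x assume "x \<in> {T..t}"
    then have "(\<Psi> has_real_derivative ?\<psi> x) (at x within {T..t})"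
      using T by (intro has_field_derivative_at_within[OF \<Psi>_deriv]) auto
    then show "(\<Psi> has_vector_derivative ?\<psi> x) (at x within {T..t})"
      by (simp only: has_real_derivative_iff_has_vector_derivative)
  qed
  have split: "integral {0..t} ?\<psi> = integral {0..T} ?\<psi> + (\<Psi> t - \<Psi> T)" if "t \<ge> T" for t
    using Henstock_Kurzweil_Integration.integral_combine[OF _ that HK(1)[of t]] ftc[OF that] T that by simp
  have "integral {T..t} (\<lambda>u. \<bar>?\<psi> u\<bar>) = integral {T..t} ?\<psi>" for t
    using \<psi>0 by (intro Henstock_Kurzweil_Integration.integral_cong) auto
  then have split_abs: "integral {0..t} (\<lambda>u. \<bar>?\<psi> u\<bar>) = integral {0..T} (\<lambda>u. \<bar>?\<psi> u\<bar>) + (\<Psi> t - \<Psi> T)" if "t \<ge> T" for t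
    using Henstock_Kurzweil_Integration.integral_combine[OF _ that HK_abs(1)[of t]] ftc[OF that] T that by simp
  define I0 where "I0 = integral {0..T} (\<lambda>u. \<bar>?\<psi> u\<bar>)"
  have le_I0: "\<bar>integral {0..T} ?\<psi>\<bar> \<le> I0"
    unfolding I0_def using integral_norm_bound_integral[OF HK(1)[OF T] HK_abs(1)[OF T]] by simp
  show ?thesis
  proof (rule that[of "I0 + \<bar>\<Psi> T\<bar>"])
    show "I0 + \<bar>\<Psi> T\<bar> \<ge> 0" using le_I0 by linarith
    show "(LINT u:{0..t}|lborel. \<bar>?\<psi> u\<bar>) \<le> I0 + \<bar>\<Psi> T\<bar> + 2 * A a t" if "t > 0" for t
    proof (cases "t \<ge> T")
      case True
      then show ?thesis
        using split_abs[OF True] le[OF True] HK_abs(2)[OF that] by (simp add: I0_def)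
    next
      case False
      then have "integral {0..t} (\<lambda>u. \<bar>?\<psi> u\<bar>) \<le> I0"
        unfolding I0_def using HK_abs(1)[OF that] HK_abs(1)[OF T] by (intro integral_subset_le) auto
      then show ?thesis using HK_abs(2)[OF that] A0[of t] by simp
    qed
    show "\<bar>(LINT u:{0..t}|lborel. ?\<psi> u) - \<Psi> t\<bar> \<le> I0 + \<bar>\<Psi> T\<bar>" if "t \<ge> T" for t
      using split[OF that] HK(2)[of t] le_I0 T that by simp
  qed
qed

section \<open>Discrepancy in residue classes\<close>

lemma sum_residue_eq_A_res:
  fixes a :: "nat \<Rightarrow> real"
  assumes "h < q" "t \<ge> 0"
  shows "(\<Sum>k | real k \<le> t. if k mod q = h then a k else 0) = (if h = 0 then a 0 else 0) + A_res a q h t"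
proof -
  let ?N = "{k. 1 \<le> k \<and> real k \<le> t}"
  have fin: "finite ?N" by simp
  \<comment> \<open>The sum begins at \<open>k = 0\<close> but \<open>A_res\<close> at 1; the extra
    term \<open>a 0\<close> belongs to the class \<open>h = 0\<close>.\<close>
  have "{k. real k \<le> t} = insert 0 ?N" using assms(2) by auto
  then have "(\<Sum>k | real k \<le> t. if k mod q = h then a k else 0)
      = (if 0 mod q = h then a 0 else 0) + (\<Sum>k\<in>?N. if k mod q = h then a k else 0)"
    using sum.insert[OF fin, of 0] by simp
  also have "(\<Sum>k\<in>?N. if k mod q = h then a k else 0) = A_res a q h t"
  proof -
    have "{x. 1 \<le> x \<and> real x \<le> t \<and> [x = h] (mod q)} = {x \<in> ?N. x mod q = h}"
      using assms(1) by (auto simp: cong_def)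
    then show ?thesis unfolding A_res_def by (simp only: sum.inter_filter[OF fin])
  qed
  finally show ?thesis by (cases "h = 0") simp_all
qed

lemma filterlim_div_ln_power: "filterlim (\<lambda>X::real. X / ln X ^ B) at_top at_top"
  by real_asymp

text \<open>Keeps the logarithm at every point beyond \<open>X / ln X ^ B\<close> at least half of
  \<open>ln X\<close>.\<close>

lemma eventually_sqrt_le_div_ln_power: "\<forall>\<^sub>F X::real in at_top. sqrt X \<le> X / ln X ^ B"
  by real_asymp

text \<open>Three comparisons are chained: the residue class with
  \<open>\<kappa> q h * A a t\<close>, then \<open>A\<close> with \<open>\<Psi>\<close>, then
  \<open>\<Psi>\<close> with the integral of its derivative. One pair \<open>B\<close>,
  \<open>C\<close> serves all \<open>q\<close>, \<open>h\<close> and \<open>t\<close>. The other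
  bounds are the total masses that multiply the discrepancy when several coordinates are
  treated.\<close>

lemma uniform_discrepancy:
  assumes a: "\<And>x. a x \<ge> 0" "\<exists>x\<ge>1. a x \<noteq> 0" and cond: "condition_D a Q\<^sub>D \<kappa>"
    and m: "m > 0" and \<Psi>: "smooth_approx a m \<Psi>"
  obtains B :: nat and C :: real where "C \<ge> 0"
    "\<forall>\<^sub>F X in at_top. X > 0 \<and> ln X > 0 \<and>
      (LINT u:{0..X}|lborel. \<bar>deriv \<Psi> u\<bar>) \<le> C * A a X \<and>
      (\<Sum>k | real k \<le> X. a k) \<le> C * A a X \<and>
      (\<forall>q h. 1 \<le> q \<longrightarrow> real q \<le> Q\<^sub>D (X / ln X ^ B) \<longrightarrow> h < q \<longrightarrow>
        0 \<le> \<kappa> q h \<and> \<kappa> q h \<le> C \<and>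
        (\<forall>t\<in>{0..X}. \<bar>(\<Sum>k | real k \<le> t. if k mod q = h then a k else 0)
            - \<kappa> q h * (LINT u:{0..t}|lborel. deriv \<Psi> u)\<bar> \<le> C * (A a X / ln X ^ m)))"
proof -
  have A0: "A a X \<ge> 0" for X using a(1) by (rule A_nonneg)
  obtain T K \<delta> where T: "T \<ge> exp 1" "\<delta> > 0" "K \<ge> 0" "A a T > 0"
    and \<psi>0: "\<And>X. X \<ge> T \<Longrightarrow> deriv \<Psi> X \<ge> 0"
    and close: "\<And>X. X \<ge> T \<Longrightarrow> \<bar>\<Psi> X - A a X\<bar> \<le> K * (A a X / ln X ^ m)"
    and \<Psi>_le: "\<And>X. X \<ge> T \<Longrightarrow> \<Psi> X \<le> 2 * A a X"
    and growth: "\<And>X Y. T \<le> X \<Longrightarrow> X \<le> Y \<Longrightarrow> A a X * Y powr \<delta> \<le> 4 * A a Y * X powr \<delta>"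
    using smooth_approx_growth[OF a m \<Psi>] by metis
  have Tpos: "T > 0" using T(1) by (meson exp_gt_zero less_le_trans)
  define F where "F t = (LINT u:{0..t}|lborel. deriv \<Psi> u)" for t
  define V where "V t = (LINT u:{0..t}|lborel. \<bar>deriv \<Psi> u\<bar>)" for t
  obtain K1 where K1: "K1 \<ge> 0" and V: "\<And>t. t > 0 \<Longrightarrow> V t \<le> K1 + 2 * A a t"
    and F\<Psi>: "\<And>t. t \<ge> T \<Longrightarrow> \<bar>F t - \<Psi> t\<bar> \<le> K1"
    unfolding V_def F_def using smooth_approx_primitive[OF a(1) \<Psi> Tpos \<psi>0 \<Psi>_le] by metis
  have FV: "\<bar>F t\<bar> \<le> V t" for t
    using integral_norm_bound[of lborel "\<lambda>u. indicator {0..t} u *\<^sub>R deriv \<Psi> u"]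
    by (simp add: F_def V_def set_lebesgue_integral_def abs_mult)
  have F_le: "\<bar>F t\<bar> \<le> K1 + 2 * A a t" if "t \<ge> 0" for t
  \<comment> \<open>The bound on \<open>V\<close> is stated for positive \<open>t\<close>; at 0 the
    integral is over a single point.\<close>
  proof (cases "t = 0")
    case True
    have "(\<lambda>u. indicator {0..0} u *\<^sub>R deriv \<Psi> u) = (\<lambda>u. indicator {0} u *\<^sub>R deriv \<Psi> 0)"
      by (auto split: split_indicator)
    then have "F 0 = 0"
      unfolding F_def set_lebesgue_integral_def by simp
    then show ?thesis using True K1 A0[of 0] by simp
  next
    case False
    then show ?thesis using V[of t] FV[of t] that by linarith
  qed
  have mono: "mono_on {1<..} Q\<^sub>D"
    and \<kappa>0: "\<And>X q h. X > 1 \<Longrightarrow> q \<ge> 1 \<Longrightarrow> real q \<le> Q\<^sub>D X \<Longrightarrow> h < q \<Longrightarrow> \<kappa> q h \<ge> 0"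
    using cond unfolding condition_D_def by blast+
  have "\<exists>C. \<forall>X>1. \<forall>q\<ge>1. real q \<le> Q\<^sub>D X \<longrightarrow>
      (\<forall>h<q. \<bar>A_res a q h X - \<kappa> q h * A a X\<bar> \<le> C * (A a X / ln X ^ m))"
    using cond unfolding condition_D_def by blast
  then obtain C0 where C0: "\<And>X q h. X > 1 \<Longrightarrow> q \<ge> 1 \<Longrightarrow> real q \<le> Q\<^sub>D X \<Longrightarrow> h < q \<Longrightarrow>
      \<bar>A_res a q h X - \<kappa> q h * A a X\<bar> \<le> C0 * (A a X / ln X ^ m)"
    by blast
  define CD where "CD = \<bar>C0\<bar>"
  have CD0: "CD \<ge> 0" by (simp add: CD_def)
  have CD: "\<bar>A_res a q h X - \<kappa> q h * A a X\<bar> \<le> CD * (A a X / ln X ^ m)"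
    if "X > 1" "q \<ge> 1" "real q \<le> Q\<^sub>D X" "h < q" for X q h
  proof -
    have "C0 * (A a X / ln X ^ m) \<le> CD * (A a X / ln X ^ m)"
      unfolding CD_def using A0[of X] that(1) by (intro mult_right_mono) auto
    then show ?thesis using C0[OF that] by linarith
  qed
  \<comment> \<open>Large enough that lowering the argument by \<open>ln X ^ B\<close> lowers
    \<open>A\<close> by at least \<open>ln X ^ m\<close>, up to a constant, given growth of exponent
    \<open>\<delta>\<close>.\<close>
  define B where "B = nat \<lceil>real m / \<delta>\<rceil>"
  have B: "real B * \<delta> \<ge> real m"
  proof -
    have "real m / \<delta> \<le> real B" unfolding B_def by linarith
    then show ?thesis using T(2) by (simp add: field_simps)
  qed
  \<comment> \<open>Since \<open>A a T \<le> A a Z \<le> 4 * R\<close> below, this gives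
    \<open>1 \<le> c0 * R\<close>, so additive constants can be absorbed into multiples of
    \<open>R\<close>.\<close>
  define c0 where "c0 = 4 / A a T"
  have c0: "c0 > 0" using T(4) by (simp add: c0_def)
  \<comment> \<open>\<open>C3\<close> gathers the terms of the discrepancy bound
    \<open>main\<close>, after \<open>A a Z\<close> is replaced by \<open>4 * R\<close> and
    constants by multiples of \<open>R\<close>; \<open>C2\<close> does the same for the two
    masses.\<close>
  define C3 where "C3 = (a 0 + (1 + CD) * K1) * c0 + (1 + 2 * (1 + CD)) * 4 + (CD + (1 + CD) * K) * 2 ^ m"
  define C2 where "C2 = a 0 * c0 + K1 * c0 + 3"
  define C where "C = (1 + CD) + C2 + C3"
  have nonneg: "a 0 * c0 \<ge> 0" "K1 * c0 \<ge> 0"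
    using a(1)[of 0] c0 K1 by auto
  have C23: "C2 \<ge> 0" "C3 \<ge> 0"
    using a(1)[of 0] c0 K1 CD0 T(3) by (simp_all add: C2_def C3_def)
  have "\<forall>\<^sub>F X in at_top. T \<le> X / ln X ^ B"
    using filterlim_div_ln_power[of B] unfolding filterlim_at_top by blast
  then have "\<forall>\<^sub>F X in at_top. X > 0 \<and> ln X > 0 \<and> V X \<le> C * A a X \<and>
      (\<Sum>k | real k \<le> X. a k) \<le> C * A a X \<and>
      (\<forall>q h. 1 \<le> q \<longrightarrow> real q \<le> Q\<^sub>D (X / ln X ^ B) \<longrightarrow> h < q \<longrightarrow>
        0 \<le> \<kappa> q h \<and> \<kappa> q h \<le> C \<and>
        (\<forall>t\<in>{0..X}. \<bar>(\<Sum>k | real k \<le> t. if k mod q = h then a k else 0)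
            - \<kappa> q h * F t\<bar> \<le> C * (A a X / ln X ^ m)))"
    using eventually_ge_at_top[of T] eventually_sqrt_le_div_ln_power[of B]
  proof eventually_elim
    case (elim X)
    define Z where "Z = X / ln X ^ B"
    define R where "R = A a X / ln X ^ m"
    have X: "X > 0" "X \<ge> exp 1" "T \<le> X" using elim(2) T(1) Tpos by linarith+
    have lnX: "ln X \<ge> 1" using X by (simp add: ln_ge_iff)
    then have lnX0: "ln X > 0" by simp
    have Z: "T \<le> Z" "sqrt X \<le> Z" using elim by (simp_all add: Z_def)
    have ZX: "Z \<le> X"
      using X(1) lnX0 mult_left_mono[OF one_le_power[OF lnX, of B], of X] by (simp add: Z_def pos_divide_le_eq)
    have Z1: "Z > 1" using Z(1) T(1) exp_ge_add_one_self[of 1] by linarith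
    \<comment> \<open>Growth between \<open>Z\<close> and \<open>X\<close> gives a saving of
      \<open>(ln X ^ B) powr \<delta>\<close>, which is at least \<open>ln X ^ m\<close>.\<close>
    have AZ: "A a Z \<le> 4 * R"
    proof -
      have "ln X ^ m \<le> ln X powr (real B * \<delta>)"
        using powr_mono[OF B lnX] lnX by (simp add: powr_realpow)
      also have "\<dots> = (ln X ^ B) powr \<delta>"
        using lnX by (simp add: powr_powr flip: powr_realpow)
      finally have le: "ln X ^ m \<le> (ln X ^ B) powr \<delta>" .
      have "A a Z * X powr \<delta> \<le> 4 * A a X * Z powr \<delta>"
        by (rule growth[OF Z(1) ZX])
      also have "Z powr \<delta> = X powr \<delta> / (ln X ^ B) powr \<delta>"
        by (simp add: Z_def powr_divide)
      also have "4 * A a X * (X powr \<delta> / (ln X ^ B) powr \<delta>) \<le> 4 * A a X * (X powr \<delta> / ln X ^ m)"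
        using le A0[of X] lnX by (intro mult_left_mono divide_left_mono mult_pos_pos) auto
      also have "\<dots> = 4 * R * X powr \<delta>" by (simp add: R_def)
      finally show ?thesis using X(1) by simp
    qed
    have "A a T \<le> A a Z" by (rule A_mono[where a = a, OF a(1) Z(1)])
    then have R1: "1 \<le> c0 * R" using AZ T(4) by (simp add: c0_def field_simps)
    have R0: "R \<ge> 0" using A0[of X] lnX by (simp add: R_def)
    have RA: "R \<le> A a X"
      using A0[of X] lnX0 mult_left_mono[OF one_le_power[OF lnX, of m], of "A a X"]
      by (simp add: R_def pos_divide_le_eq)
    have const: "k \<le> k * c0 * R" if "k \<ge> 0" for k
      using mult_left_mono[OF R1 that] by (simp add: mult.assoc)
    have constA: "k \<le> k * c0 * A a X" if "k \<ge> 0" for k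
      using const[OF that] mult_left_mono[OF RA, of "k * c0"] that c0 by simp
    have C_ge: "C2 \<le> C" "1 + CD \<le> C" "C3 \<le> C"
      unfolding C_def using C23 CD0 by linarith+
    have CA: "C2 * A a X \<le> C * A a X"
      using C_ge(1) A0 by (rule mult_right_mono)
    have VX: "V X \<le> C * A a X"
    proof -
      have "V X \<le> K1 + 2 * A a X" by (rule V[OF X(1)])
      also have "\<dots> \<le> C2 * A a X"
        using constA[OF K1] mult_nonneg_nonneg[OF nonneg(1) A0[of X]] A0[of X] by (simp add: C2_def distrib_right)
      finally show ?thesis using CA by linarith
    qed
    \<comment> \<open>The full sum is the case of modulus 1, where 0 is the only class.\<close>
    have "(\<Sum>k | real k \<le> X. a k) = a 0 + A_res a 1 0 X"
      using sum_residue_eq_A_res[of 0 1 X a] X(1) by simp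
    also have "\<dots> \<le> a 0 + A a X" using A_res_le_A[where a = a, OF a(1), of 1 0 X] a(1) by simp
    also have "\<dots> \<le> C2 * A a X"
      using constA[OF a(1)[of 0]] mult_nonneg_nonneg[OF nonneg(2) A0[of X]] A0[of X] by (simp add: C2_def distrib_right)
    finally have SX: "(\<Sum>k | real k \<le> X. a k) \<le> C * A a X" using CA by linarith
    have "0 \<le> \<kappa> q h \<and> \<kappa> q h \<le> C \<and>
        (\<forall>t\<in>{0..X}. \<bar>(\<Sum>k | real k \<le> t. if k mod q = h then a k else 0) - \<kappa> q h * F t\<bar> \<le> C * R)"
      if q: "1 \<le> q" "real q \<le> Q\<^sub>D Z" "h < q" for q h
    proof -
      \<comment> \<open>Because \<open>Q\<^sub>D\<close> is monotone, the bound on \<open>q\<close>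
        at \<open>Z\<close> makes Condition D available at every \<open>t \<ge> Z\<close>.\<close>
      have Qt: "real q \<le> Q\<^sub>D t" if "Z \<le> t" for t
        using mono_onD[OF mono, of Z t] Z1 that q(2) by simp
      have k0: "0 \<le> \<kappa> q h" using \<kappa>0[OF Z1 q] .
      have AX: "A a X > 0" using A_mono[where a = a, OF a(1) X(3)] T(4) by linarith
      \<comment> \<open>A class has at most the total mass, so Condition D at \<open>X\<close>,
        divided by \<open>A a X > 0\<close>, bounds the density uniformly.\<close>
      have "\<kappa> q h * A a X \<le> A_res a q h X + CD * R"
        using CD[of X q h] q Qt[OF ZX] ZX Z1 unfolding R_def by linarith
      also have "\<dots> \<le> A a X + CD * A a X"
        using A_res_le_A[where a = a, OF a(1), of q h X] a(1) mult_left_mono[OF RA CD0] by linarith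
      finally have "\<kappa> q h * A a X \<le> (1 + CD) * A a X" by (simp add: distrib_right)
      then have k1: "\<kappa> q h \<le> 1 + CD" using AX by simp
      let ?S = "\<lambda>t. \<Sum>k | real k \<le> t. if k mod q = h then a k else 0"
      have S: "\<bar>?S t - A_res a q h t\<bar> \<le> a 0" if "t \<ge> 0" for t
        using sum_residue_eq_A_res[OF q(3) that, of a] a(1)[of 0] by simp
      have main: "\<bar>?S t - \<kappa> q h * F t\<bar> \<le> a 0 + (1 + CD) * K1
          + (1 + 2 * (1 + CD)) * A a Z + (CD + (1 + CD) * K) * (2 ^ m * R)" if t: "t \<in> {0..X}" for t
      \<comment> \<open>Equidistribution modulo \<open>q\<close> is available only from \<open>Z\<close> on; below \<open>Z\<close> everything is \<open>O(A(Z))\<close>,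
        which \<open>B \<ge> m/\<delta>\<close> makes negligible.\<close>
      proof (cases "t \<le> Z")
        case True
        have "A a t \<le> A a Z" using True a(1) by (intro A_mono)
        have "\<bar>\<kappa> q h * F t\<bar> \<le> (1 + CD) * (K1 + 2 * A a t)"
          unfolding abs_mult using k0 k1 F_le[of t] t by (intro mult_mono) auto
        also have "\<dots> \<le> (1 + CD) * (K1 + 2 * A a Z)"
          using \<open>A a t \<le> A a Z\<close> CD0 by (intro mult_left_mono) auto
        also have "\<dots> = (1 + CD) * K1 + 2 * (1 + CD) * A a Z" by (simp add: algebra_simps)
        finally have "\<bar>\<kappa> q h * F t\<bar> \<le> (1 + CD) * K1 + 2 * (1 + CD) * A a Z" .
        moreover have "\<bar>?S t\<bar> \<le> a 0 + A a Z"
          using S[of t] t A_res_le_A[where a = a, OF a(1), of q h t] A_res_nonneg[where a = a, OF a(1), of q h t] a(1) \<open>A a t \<le> A a Z\<close>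
          by (simp add: abs_le_iff)
        moreover have "0 \<le> (CD + (1 + CD) * K) * (2 ^ m * R)"
          using CD0 T(3) R0 by simp
        ultimately show ?thesis by (simp add: distrib_right)
      next
        case False
        have t1: "t > 1" "t \<ge> T" using False Z Z1 by auto
        \<comment> \<open>As \<open>t\<close> exceeds \<open>sqrt X\<close>, an error saving
          \<open>ln t ^ m\<close> saves \<open>ln X ^ m\<close> up to the factor
          \<open>2 ^ m\<close>.\<close>
        have "ln X \<le> 2 * ln t"
        proof -
          have "ln (sqrt X) \<le> ln t" using Z(2) False X(1) t1 by (intro ln_mono) auto
          then show ?thesis using X(1) by (simp add: ln_sqrt)
        qed
        then have "ln X ^ m \<le> (2 * ln t) ^ m" using lnX by (intro power_mono) auto
        then have pw: "1 / ln t ^ m \<le> 2 ^ m / ln X ^ m"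
          using t1 lnX by (simp add: power_mult_distrib field_simps)
        have "A a t / ln t ^ m \<le> A a X * (2 ^ m / ln X ^ m)"
          using mult_mono[OF A_mono[where a = a, OF a(1), of t X] pw] t A0 t1 by simp
        also have "\<dots> = 2 ^ m * R" by (simp add: R_def)
        finally have Rt: "A a t / ln t ^ m \<le> 2 ^ m * R" .
        have e1: "\<bar>A_res a q h t - \<kappa> q h * A a t\<bar> \<le> CD * (2 ^ m * R)"
          using CD[of t q h] t1 q Qt[of t] False mult_left_mono[OF Rt CD0] by linarith
        have "\<bar>A a t - F t\<bar> \<le> K1 + K * (2 ^ m * R)"
          using close[OF t1(2)] F\<Psi>[OF t1(2)] mult_left_mono[OF Rt T(3)] by linarith
        then have "\<kappa> q h * \<bar>A a t - F t\<bar> \<le> (1 + CD) * (K1 + K * (2 ^ m * R))"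
          using k0 k1 by (intro mult_mono) auto
        moreover have "\<bar>\<kappa> q h * A a t - \<kappa> q h * F t\<bar> = \<kappa> q h * \<bar>A a t - F t\<bar>"
          using k0 by (simp add: abs_mult flip: right_diff_distrib)
        ultimately have e2: "\<bar>\<kappa> q h * A a t - \<kappa> q h * F t\<bar> \<le> (1 + CD) * K1 + (1 + CD) * K * (2 ^ m * R)"
          by (simp add: distrib_left mult.assoc)
        have "0 \<le> (1 + 2 * (1 + CD)) * A a Z" using CD0 A0[of Z] by simp
        moreover have "\<bar>?S t - A_res a q h t\<bar> \<le> a 0" using S t by simp
        ultimately show ?thesis
          using e1 e2 unfolding distrib_right[of CD "(1 + CD) * K"] by linarith
      qed
      have "a 0 + (1 + CD) * K1 + (1 + 2 * (1 + CD)) * A a Z + (CD + (1 + CD) * K) * (2 ^ m * R)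
          \<le> (a 0 + (1 + CD) * K1) * c0 * R + (1 + 2 * (1 + CD)) * (4 * R) + (CD + (1 + CD) * K) * (2 ^ m * R)"
        using a(1)[of 0] CD0 K1
        by (intro add_right_mono add_mono[OF const mult_left_mono[OF AZ]]) auto
      also have "\<dots> = C3 * R"
        unfolding C3_def by (simp add: algebra_simps)
      also have "\<dots> \<le> C * R" using C_ge(3) R0 by (rule mult_right_mono)
      finally have le: "a 0 + (1 + CD) * K1 + (1 + 2 * (1 + CD)) * A a Z + (CD + (1 + CD) * K) * (2 ^ m * R) \<le> C * R" .
      have "\<forall>t\<in>{0..X}. \<bar>?S t - \<kappa> q h * F t\<bar> \<le> C * R"
        using main le by (meson order_trans)
      then show ?thesis using k0 k1 C_ge(2) by simp
    qed
    then show ?case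
      using X(1) lnX0 VX SX unfolding R_def[symmetric] Z_def[symmetric] by auto
  qed
  moreover have "C \<ge> 0" unfolding C_def using C23 CD0 by linarith
  ultimately show ?thesis using that unfolding F_def V_def by blast
qed

section \<open>The asymptotic formula\<close>

theorem theorem4p1:
  fixes s m :: nat
    and c :: "nat \<Rightarrow> nat \<Rightarrow> int"
    and a :: "nat \<Rightarrow> real"
    and Q\<^sub>D :: "real \<Rightarrow> real"
    and \<kappa> :: "nat \<Rightarrow> nat \<Rightarrow> real"
    and \<Psi> :: "real \<Rightarrow> real"
  assumes "\<And>x. a x \<ge> 0"
    and "\<exists>x\<ge>1. a x \<noteq> 0"
    and "condition_D a Q\<^sub>D \<kappa>"
    and "smoothly_approximable a"
    and "m > 0"
    and "smooth_approx a m \<Psi>"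
  shows "\<exists>(B::nat) (C::real). \<forall>\<^sub>F X in at_top.
    \<forall>(P::real) (Q::real) (b::nat) (q::nat) (\<alpha>::real) (lam::real).
      1 \<le> b \<and> b \<le> q \<and> real q \<le> P \<and> coprime b q \<and> Q > 0 \<and>
      \<alpha> \<in> {real b / real q - 1 / Q .. real b / real q + 1 / Q} \<and>
      \<alpha> = real b / real q + lam \<and>
      real q \<le> Q\<^sub>D (X / ln X ^ B) \<longrightarrow>
      norm (exp_sum s c a X \<alpha> - gauss_sum s c \<kappa> q b * sing_int s c (deriv \<Psi>) lam X)
        \<le> C * (real q ^ s * max 1 (\<bar>lam\<bar> * X\<^sup>2) * A a X ^ s / ln X ^ m)"
proof -
  obtain B C where C: "C \<ge> 0" and ev: "\<forall>\<^sub>F X in at_top. X > 0 \<and> ln X > 0 \<and>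
      (LINT u:{0..X}|lborel. \<bar>deriv \<Psi> u\<bar>) \<le> C * A a X \<and>
      (\<Sum>k | real k \<le> X. a k) \<le> C * A a X \<and>
      (\<forall>q h. 1 \<le> q \<longrightarrow> real q \<le> Q\<^sub>D (X / ln X ^ B) \<longrightarrow> h < q \<longrightarrow>
        0 \<le> \<kappa> q h \<and> \<kappa> q h \<le> C \<and>
        (\<forall>t\<in>{0..X}. \<bar>(\<Sum>k | real k \<le> t. if k mod q = h then a k else 0)
            - \<kappa> q h * (LINT u:{0..t}|lborel. deriv \<Psi> u)\<bar> \<le> C * (A a X / ln X ^ m)))"
    by (rule uniform_discrepancy[OF assms(1-3,5,6)])
  define Sc where "Sc = (\<Sum>i<s. \<Sum>j\<le>i. real_of_int \<bar>c i j\<bar>)"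
  have Sc: "Sc \<ge> 0" unfolding Sc_def by (intro sum_nonneg) auto
  \<comment> \<open>One mass constant for both sides: the sums are at most \<open>C * A a X\<close>,
    the integrals, which carry a density of size at most \<open>C\<close>, at most
    \<open>C * C * A a X\<close>.\<close>
  define C1 where "C1 = C + C * C"
  have C1: "C1 \<ge> 0" "C \<le> C1" "C * C \<le> C1" using C by (simp_all add: C1_def)
  \<comment> \<open>The last factor comes from \<open>1 + K * X\<close> with the derivative bound
    \<open>K\<close> below, which is at most \<open>1 + 4 * pi * Sc\<close> times the maximum in the
    error term.\<close>
  define C2 where "C2 = real s * C1 ^ (s - 1) * C * (1 + 4 * pi * Sc)"
  have "\<forall>\<^sub>F X in at_top. \<forall>(P::real) (Q::real) (b::nat) (q::nat) (\<alpha>::real) (lam::real).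
      1 \<le> b \<and> b \<le> q \<and> real q \<le> P \<and> coprime b q \<and> Q > 0 \<and>
      \<alpha> \<in> {real b / real q - 1 / Q .. real b / real q + 1 / Q} \<and>
      \<alpha> = real b / real q + lam \<and>
      real q \<le> Q\<^sub>D (X / ln X ^ B) \<longrightarrow>
      norm (exp_sum s c a X \<alpha> - gauss_sum s c \<kappa> q b * sing_int s c (deriv \<Psi>) lam X)
        \<le> C2 * (real q ^ s * max 1 (\<bar>lam\<bar> * X\<^sup>2) * A a X ^ s / ln X ^ m)"
    using ev
  proof (eventually_elim, intro allI impI, elim conjE)
    fix X P Q \<alpha> lam :: real and b q :: nat
    assume X: "X > 0" "ln X > 0" and VX: "(LINT u:{0..X}|lborel. \<bar>deriv \<Psi> u\<bar>) \<le> C * A a X"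
      and SX: "(\<Sum>k | real k \<le> X. a k) \<le> C * A a X"
      and disc: "\<forall>q h. 1 \<le> q \<longrightarrow> real q \<le> Q\<^sub>D (X / ln X ^ B) \<longrightarrow> h < q \<longrightarrow>
        0 \<le> \<kappa> q h \<and> \<kappa> q h \<le> C \<and>
        (\<forall>t\<in>{0..X}. \<bar>(\<Sum>k | real k \<le> t. if k mod q = h then a k else 0)
            - \<kappa> q h * (LINT u:{0..t}|lborel. deriv \<Psi> u)\<bar> \<le> C * (A a X / ln X ^ m))"
      and b: "1 \<le> b" "b \<le> q" and \<alpha>: "\<alpha> = real b / real q + lam" and q: "real q \<le> Q\<^sub>D (X / ln X ^ B)"
    have q1: "1 \<le> q" using b by simp
    have A0: "A a X \<ge> 0" using assms(1) by (rule A_nonneg)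
    define R where "R = A a X / ln X ^ m"
    have R0: "R \<ge> 0" using A0 X by (simp add: R_def)
    define G where "G u = e (lam * qform s c u)" for u
    define H where "H k u = of_real (2 * pi * lam * qform_deriv s c k u) * \<i> * e (lam * qform s c u)" for k u
    define K where "K = 4 * pi * \<bar>lam\<bar> * Sc * X"
    \<comment> \<open>The cut-off lets the coordinate integrals run over the whole line while
      supported on [0,X].\<close>
    define \<psi> where "\<psi> u = indicator {0..X} u * deriv \<Psi> u" for u
    have int: "integrable lborel \<psi>"
      using assms(6) X(1) unfolding smooth_approx_def set_integrable_def \<psi>_def by simp
    let ?H = "{..<s} \<rightarrow>\<^sub>E {..<q}" and ?N = "{n. real n \<le> X}"
    let ?f = "\<lambda>h. qform s c (\<lambda>i. real (h i :: nat))"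
    let ?S = "\<lambda>h. \<Sum>x\<in>{..<s} \<rightarrow>\<^sub>E ?N. of_real (\<Prod>i<s. if x i mod q = h i then a (x i) else 0) * e (lam * ?f x)"
    let ?J = "\<lambda>h. LINT u|(\<Pi>\<^sub>M i\<in>{..<s}. lborel). of_real (\<Prod>i<s. \<kappa> q (h i) * \<psi> (u i)) * e (lam * qform s c u)"
    have bound: "norm (?S h - ?J h) \<le> real s * (C1 * A a X) ^ (s - 1) * (C * R * (1 + K * X))" if h: "h \<in> ?H" for h
    proof -
      have hq: "h i < q" if "i < s" for i using PiE_mem[OF h, of i] that by simp
      have \<kappa>: "0 \<le> \<kappa> q (h i)" "\<kappa> q (h i) \<le> C" if "i < s" for i
        using disc[rule_format, OF q1 q hq[OF that]] by simp_all
      show ?thesis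
        unfolding G_def[symmetric]
      proof (rule product_discrepancy[where H = H and w = "\<lambda>i k. if k mod q = h i then a k else 0"
            and \<phi> = "\<lambda>i u. \<kappa> q (h i) * \<psi> u"])
        show "0 \<le> X" "0 \<le> C1 * A a X" "0 \<le> C * R" "0 \<le> K"
          using X C C1 R0 A0 Sc by (simp_all add: K_def)
        show "(\<Sum>k\<in>?N. \<bar>if k mod q = h i then a k else 0\<bar>) \<le> C1 * A a X" for i
        proof -
          have "(\<Sum>k\<in>?N. \<bar>if k mod q = h i then a k else 0\<bar>) \<le> (\<Sum>k\<in>?N. a k)"
            using assms(1) by (intro sum_mono) auto
          also have "\<dots> \<le> C1 * A a X" using SX mult_right_mono[OF C1(2) A0] by linarith
          finally show ?thesis .
        qed
        show "integrable lborel (\<lambda>u. \<kappa> q (h i) * \<psi> u)" for i using int by simp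
        show "\<kappa> q (h i) * \<psi> t = 0" if "t \<notin> {0..X}" for i t using that by (simp add: \<psi>_def)
        show "(LINT t|lborel. \<bar>\<kappa> q (h i) * \<psi> t\<bar>) \<le> C1 * A a X" if "i < s" for i
        proof -
          have "(LINT t|lborel. \<bar>\<kappa> q (h i) * \<psi> t\<bar>) = \<kappa> q (h i) * (LINT u:{0..X}|lborel. \<bar>deriv \<Psi> u\<bar>)"
            using \<kappa>(1)[OF that] by (simp add: abs_mult \<psi>_def set_lebesgue_integral_def)
          also have "\<dots> \<le> \<kappa> q (h i) * (C * A a X)"
            using VX \<kappa>(1)[OF that] by (rule mult_left_mono)
          also have "\<dots> \<le> C * (C * A a X)"
            using \<kappa>(2)[OF that] C A0 by (intro mult_right_mono) auto
          also have "\<dots> \<le> C1 * A a X" using mult_right_mono[OF C1(3) A0] by (simp add: mult.assoc)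
          finally show ?thesis .
        qed
        show "\<bar>(\<Sum>k | real k \<le> t. if k mod q = h i then a k else 0) - (LINT u:{0..t}|lborel. \<kappa> q (h i) * \<psi> u)\<bar> \<le> C * R"
          if "i < s" "t \<in> {0..X}" for i t
        proof -
          have "(LINT u:{0..t}|lborel. \<kappa> q (h i) * \<psi> u) = (LINT u:{0..t}|lborel. \<kappa> q (h i) * deriv \<Psi> u)"
            using that(2) unfolding set_lebesgue_integral_def
            by (intro Bochner_Integration.integral_cong) (auto simp: \<psi>_def split: split_indicator)
          also have "\<dots> = \<kappa> q (h i) * (LINT u:{0..t}|lborel. deriv \<Psi> u)"
            by (rule set_integral_mult_right)
          finally have eq: "(LINT u:{0..t}|lborel. \<kappa> q (h i) * \<psi> u)
              = \<kappa> q (h i) * (LINT u:{0..t}|lborel. deriv \<Psi> u)" .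
          show ?thesis
            unfolding eq R_def using disc[rule_format, OF q1 q hq[OF that(1)]] that(2) by blast
        qed
        show "G \<in> borel_measurable (\<Pi>\<^sub>M i\<in>{..<s}. lborel)" unfolding G_def by measurable
        show "G u = G v" if "\<And>i. i < s \<Longrightarrow> u i = v i" for u v
          unfolding G_def using qform_cong[of s u v c] that by simp
        show "norm (G u) \<le> 1" for u by (simp add: G_def)
        show "((\<lambda>t. G (u(i := t))) has_vector_derivative H i (u(i := t))) (at t)" for i u t
          unfolding G_def H_def by (rule e_qform_has_derivative)
        show "continuous_on UNIV (\<lambda>t. H i (u(i := t)))" for i u
        proof -
          \<comment> \<open>Continuity of the phase along a coordinate line follows from its
            differentiability there.\<close>
          have "continuous_on UNIV (\<lambda>t. e (lam * qform s c (u(i := t))))"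
            using e_qform_has_derivative has_vector_derivative_continuous
            by (metis continuous_at_imp_continuous_on)
          then show ?thesis
            unfolding H_def by (intro continuous_intros continuous_qform_deriv)
        qed
        show "norm (H i u) \<le> K" if "\<And>j. j < s \<Longrightarrow> u j \<in> {0..X}" for i u
        proof -
          have "norm (H i u) = 2 * pi * \<bar>lam\<bar> * \<bar>qform_deriv s c i u\<bar>"
            by (simp add: H_def norm_mult)
          also have "\<dots> \<le> 2 * pi * \<bar>lam\<bar> * (Sc * (2 * X))"
            unfolding Sc_def using X(1) that by (intro mult_left_mono qform_deriv_le) auto
          also have "\<dots> = K" by (simp add: K_def)
          finally show ?thesis .
        qed
      qed
    qed
    have J: "of_real (\<Prod>i<s. \<kappa> q (h i)) * sing_int s c (deriv \<Psi>) lam X = ?J h" for h :: "nat \<Rightarrow> nat"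
      unfolding \<psi>_def by (rule kappa_sing_int)
    have gauss: "gauss_sum s c \<kappa> q b * sing_int s c (deriv \<Psi>) lam X = (\<Sum>h\<in>?H. e (real b / real q * ?f h) * ?J h)"
      unfolding gauss_sum_def sum_distrib_right J[symmetric]
      by (intro sum.cong refl) (simp only: mult_ac)
    have "norm (exp_sum s c a X \<alpha> - gauss_sum s c \<kappa> q b * sing_int s c (deriv \<Psi>) lam X)
        = norm (\<Sum>h\<in>?H. e (real b / real q * ?f h) * (?S h - ?J h))"
      unfolding exp_sum_residues[OF q1 \<alpha>] gauss by (simp only: sum_subtractf right_diff_distrib)
    also have "\<dots> \<le> (\<Sum>h\<in>?H. real s * (C1 * A a X) ^ (s - 1) * (C * R * (1 + K * X)))"
      using bound by (intro sum_norm_le) (simp add: norm_mult)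
    \<comment> \<open>The rational phases have modulus 1, so each of the \<open>q ^ s\<close>
      classes contributes the same bound.\<close>
    also have "\<dots> = real q ^ s * (real s * (C1 * A a X) ^ (s - 1) * (C * R * (1 + K * X)))"
      by (simp add: card_PiE)
    also have "\<dots> = real q ^ s * (real s * C1 ^ (s - 1) * C * (1 + 4 * pi * Sc * (\<bar>lam\<bar> * X\<^sup>2)) * (A a X ^ s / ln X ^ m))"
      \<comment> \<open>For \<open>s > 0\<close> the powers \<open>A a X ^ (s - 1)\<close> and
        \<open>A a X\<close> combine; for \<open>s = 0\<close> the factor \<open>real s\<close>
        makes both sides zero.\<close>
      by (cases s) (simp_all add: R_def K_def power_mult_distrib power2_eq_square)
    also have "\<dots> \<le> real q ^ s * (real s * C1 ^ (s - 1) * C * ((1 + 4 * pi * Sc) * max 1 (\<bar>lam\<bar> * X\<^sup>2)) * (A a X ^ s / ln X ^ m))"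
    proof -
      have "1 + 4 * pi * Sc * (\<bar>lam\<bar> * X\<^sup>2) \<le> max 1 (\<bar>lam\<bar> * X\<^sup>2) + 4 * pi * Sc * max 1 (\<bar>lam\<bar> * X\<^sup>2)"
        using Sc by (intro add_mono mult_left_mono) auto
      then have "1 + 4 * pi * Sc * (\<bar>lam\<bar> * X\<^sup>2) \<le> (1 + 4 * pi * Sc) * max 1 (\<bar>lam\<bar> * X\<^sup>2)"
        by (simp add: distrib_right)
      then show ?thesis
        using C C1(1) A0 X by (intro mult_left_mono mult_right_mono) auto
    qed
    also have "\<dots> = C2 * (real q ^ s * max 1 (\<bar>lam\<bar> * X\<^sup>2) * A a X ^ s / ln X ^ m)"
      by (simp add: C2_def)
    finally show "norm (exp_sum s c a X \<alpha> - gauss_sum s c \<kappa> q b * sing_int s c (deriv \<Psi>) lam X)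
        \<le> C2 * (real q ^ s * max 1 (\<bar>lam\<bar> * X\<^sup>2) * A a X ^ s / ln X ^ m)" .
  qed
  then show ?thesis by (intro exI)
qed

end
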